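(* Let $D$ be a strong digraph on $n$ vertices with minimum semi-degree at least two (i.e. $d^+(v)\ge 2$ and $d^-(v)\ge 2$ for every vertex $v$ of $D$). Suppose that $$d(x)+d(y)\geq 2n-1 \quad\text{and}\quad \min\{d(x),d(y)\}\geq n-1$$ for every pair of non-adjacent (distinct) vertices $x$ and $y$ of $D$ with a common in-neighbour (i.e. such that there is a vertex $z$ with $zx\in A(D)$ and $zy\in A(D)$). Then either $D$ contains a cycle of length $n-1$, or $n$ is even and $D$ is isomorphic to the complete bipartite digraph $K^*_{n/2,n/2}$ or to $K^*_{n/2,n/2}-\{e\}$, where $e$ is an arc of $K^*_{n/2,n/2}$.
   Context: All digraphs are finite, without loops and without multiple arcs (a pair of opposite arcs $xy$, $yx$ is allowed). For a digraph $D$, $V(D)$ is its vertex set and $A(D)$ its arc set; $xy$ denotes the arc directed from $x$ to $y$. Let $N^+(x)=\{y : xy\in A(D)\}$ be the set of out-neighbours and $N^-(x)=\{y : yx\in A(D)\}$ the set of in-neighbours of $x$. The out-degree is $d^+(x)=|N^+(x)|$, the in-degree is $d^-(x)=|N^-(x)|$ (these two are called the semi-degrees of $x$), and the degree is $d(x)=d^+(x)+d^-(x)$. Two distinct vertices $x,y$ are adjacent if $xy\in A(D)$ or $yx\in A(D)$ (or both), and non-adjacent otherwise. A digraph $D$ is strong (strongly connected) if for every choice of distinct vertices $x,y$ there is a directed path from $x$ to $y$ and a directed path from $y$ to $x$. A cycle of length $m\ge 2$ consists of distinct vertices $x_1,\dots,x_m$ together with the arcs $x_ix_{i+1}$ for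 $1\le i\le m-1$ and $x_mx_1$. The complete bipartite digraph $K^*_{p,q}$ has vertex set partitioned into two sets of cardinalities $p$ and $q$, with both arcs $xy$ and $yx$ present whenever $x$ and $y$ lie in different parts, and no other arcs. *)

theory Defs
  imports Graph_Theory.Graph_Theory
begin

definition degree :: "('a, 'b) pre_digraph \<Rightarrow> 'a \<Rightarrow> nat" where
  "degree D v = out_degree D v + in_degree D v"

definition nonadjacent :: "('a, 'b) pre_digraph \<Rightarrow> 'a \<Rightarrow> 'a \<Rightarrow> bool" where
  "nonadjacent D x y \<longleftrightarrow>
     x \<in> verts D \<and> y \<in> verts D \<and> x \<noteq> y \<and> \<not> x \<rightarrow>\<^bsub>D\<^esub> y \<and> \<not> y \<rightarrow>\<^bsub>D\<^esub> x"

definition common_in_neighbour :: "('a, 'b) pre_digraph \<Rightarrow> 'a \<Rightarrow> 'a \<Rightarrow> bool" where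
  "common_in_neighbour D x y \<longleftrightarrow> (\<exists>z \<in> verts D. z \<rightarrow>\<^bsub>D\<^esub> x \<and> z \<rightarrow>\<^bsub>D\<^esub> y)"

end

theory Submission
  imports Defs
begin

text \<open>
  Let \<open>D\<close> have \<open>n\<close> vertices and no cycle of length \<open>n - 1\<close>, and let \<open>C\<close>, with vertices \<open>x j\<close> indexed
  modulo its length, be a longest cycle among those with fewer than \<open>n\<close> vertices. The set \<open>R\<close> of the
  vertices off \<open>C\<close> has at least two elements, and every cycle longer than \<open>C\<close> is Hamiltonian; most
  steps exhibit a cycle of forbidden length.

  A bypass leaves \<open>C\<close>, runs through \<open>R\<close> and returns to \<open>C\<close>. Take one that returns as few steps
  further along \<open>C\<close> as possible. If it skipped vertices of \<open>C\<close>, the first skipped vertex and the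
  first vertex of the bypass would be non-adjacent with a common in-neighbour, and the degree
  condition would allow the skipped vertices to be inserted one by one into the rest of \<open>C\<close>.
  Inserting all of them, or all but one if the bypass contains all of \<open>R\<close>, gives a cycle of forbidden
  length (\<open>shortest_bypass_step_1\<close>). So the bypass joins consecutive vertices of \<open>C\<close>, and it contains
  all of \<open>R\<close> (\<open>spanning_R_path\<close>).

  A vertex \<open>v\<close> of \<open>R\<close> cannot be inserted into \<open>C\<close>, so of the arcs \<open>x (j - 1) \<rightarrow> v\<close> and \<open>v \<rightarrow> x j\<close> at most
  one exists, for each \<open>j\<close>. If \<open>v\<close> has in- and out-neighbours on \<open>C\<close>, then domination of \<open>v\<close> stops
  somewhere along \<open>C\<close>; this gives a non-adjacent pair with a common in-neighbour, whence \<open>v\<close> has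
  degree at least \<open>n - 1\<close>. For the two ends of the spanning path this is at most one less than what is
  possible, so their neighbourhoods on \<open>C\<close> are almost determined. This excludes three or more
  vertices in \<open>R\<close> (\<open>card_R_eq_2\<close>).

  Now \<open>R\<close> has two vertices \<open>a\<close>, \<open>b\<close>. Choose \<open>C\<close> such that their degree sum is as large as possible.
  Where domination of \<open>a\<close> stops at \<open>x (k - 1)\<close> and \<open>a\<close> dominates \<open>x (k + 1)\<close>, the vertex \<open>a\<close> can be exchanged
  for the non-adjacent vertex \<open>x k\<close>; by the choice of \<open>C\<close> it has at least the degree of \<open>x k\<close>, hence
  degree at least \<open>n\<close>. It follows that both \<open>a\<close> and
  \<open>b\<close> have degree exactly \<open>n\<close> (\<open>outside_full_degree\<close>) and that their neighbourhoods on \<open>C\<close> are the two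
  parity classes (\<open>bipartite\<close>). Exchanging \<open>a\<close> for a vertex of \<open>C\<close> shows that the classes are
  independent, and the degree condition for pairs dominated by \<open>b\<close> leaves room for at most one missing
  arc (\<open>alternates_imp_bipartite\<close>).
\<close>

section \<open>Periodic predicates on the integers\<close>

lemma residue_in_window:
  fixes m :: int
  assumes "0 < m"
  shows "\<exists>j'\<ge>k. j' < k + m \<and> m dvd (j' - j)"
proof -
  have "m dvd (k + (j - k) mod m - j)"
    using mod_eq_dvd_iff[of "(j - k) mod m" m "j - k"] by (simp add: algebra_simps)
  then show ?thesis
    using assms by (intro exI[of _ "k + (j - k) mod m"]) auto
qed

lemma end_between:
  fixes k j :: int
  assumes "P k" "\<not> P j" "k \<le> j"
  shows "\<exists>i. k \<le> i \<and> i < j \<and> P i \<and> \<not> P (i + 1)"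
proof (rule ccontr)
  assume no: "\<not> ?thesis"
  have "i \<le> j \<longrightarrow> P i" if "k \<le> i" for i
    using that
  proof (induction i rule: int_ge_induct)
    case (step i)
    then show ?case using no by auto
  qed (use assms in auto)
  then show False using assms by blast
qed

text \<open>The positions at which a cycle of length \<open>m\<close> meets the neighbourhood of a fixed vertex form such
  a predicate once the cycle is indexed by all integers. An end is a position where the
  predicate holds while it fails at the next one.\<close>

locale periodic_predicate =
  fixes P :: "int \<Rightarrow> bool" and m :: int
  assumes m_pos: "0 < m" and cong: "m dvd (i - j) \<Longrightarrow> P i = P j"
begin

lemmas representative_from = residue_in_window[OF m_pos]

lemma end_exists:
  assumes "P k" "\<not> P j"
  shows "\<exists>i. P i \<and> \<not> P (i + 1)"
proof -
  obtain j' where "k \<le> j'" "m dvd (j' - j)" using representative_from by blast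
  then show ?thesis using end_between[of P k j'] cong assms by blast
qed

text \<open>A predicate whose only end is \<open>a\<close> holds on a single circular interval; as it also
  holds at \<open>a + 2\<close>, that interval leaves out nothing but \<open>a + 1\<close>.\<close>

lemma unique_end_misses_one:
  assumes unique: "\<And>i. P i \<Longrightarrow> \<not> P (i + 1) \<Longrightarrow> m dvd (i - a)"
    and start: "P (a + 2)" and out: "\<not> P j"
  shows "m dvd (j - (a + 1))"
proof (rule ccontr)
  assume j: "\<not> ?thesis"
  obtain j' where j': "a + 2 \<le> j'" "j' < a + 2 + m" "m dvd (j' - j)"
    using representative_from by blast
  have "j' \<noteq> a + 1 + m"
  proof
    assume "j' = a + 1 + m"
    then have "m dvd (m + (a + 1 - j))" using j' by (simp add: algebra_simps)
    then have "m dvd (a + 1 - j)" by simp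
    then show False using j by (metis dvd_diff_commute)
  qed
  moreover have "\<not> P j'" using out cong j' by blast
  ultimately obtain i where i: "a + 2 \<le> i" "i < a + m" "P i" "\<not> P (i + 1)"
    using end_between[of P "a + 2" j'] start j' by force
  then have "m dvd (i - a)" using unique by blast
  then have "m \<le> i - a" using i by (intro zdvd_imp_le) auto
  then show False using i by simp
qed

text \<open>Failure of \<open>P\<close> at two consecutive positions is what the step cannot pass, so two consecutive
  positions where it holds spread it downwards, and periodicity carries it to all of the circle.\<close>

lemma downward_everywhere:
  assumes "P k" "P (k + 1)" and step: "\<And>j. P (j + 1) \<Longrightarrow> P (j + 2) \<Longrightarrow> P j"
  shows "P t"
proof -
  have "P i \<and> P (i + 1)" if "i \<le> k" for i
    using that
  proof (induction i rule: int_le_induct)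
    case (step i)
    then show ?case using assms(3)[of "i - 1"] by (simp add: add.commute)
  qed (use assms in auto)
  moreover obtain i where "i < k - m + m" "m dvd (i - t)"
    using representative_from by blast
  ultimately show ?thesis using cong by force
qed

end

section \<open>Paths and cycles as vertex lists\<close>

lemma split_at_first_failure:
  assumes "c \<in> set Q" "P c" "\<not> P (last Q)"
  shows "\<exists>ys a b zs. Q = ys @ a # b # zs \<and> P a \<and> \<not> P b"
  using assms
proof (induction Q arbitrary: c)
  case (Cons q Q)
  show ?case
  proof (cases "Q = [] \<or> P q \<and> \<not> P (hd Q)")
    case True
    then show ?thesis using Cons.prems by (cases Q) (auto intro!: exI[of _ "[]"])
  next
    case False
    then obtain c' where "c' \<in> set Q" "P c'"
      using Cons.prems by (metis hd_in_set set_ConsD)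
    then obtain ys a b zs where "Q = ys @ a # b # zs \<and> P a \<and> \<not> P b"
      using Cons.IH[of c'] Cons.prems False by auto
    then show ?thesis by (metis append_Cons)
  qed
qed simp

lemma rtranclp_distinct_path:
  assumes "R\<^sup>*\<^sup>* a b"
  shows "\<exists>p. p \<noteq> [] \<and> hd p = a \<and> last p = b \<and> distinct p \<and> successively R p"
  using assms
proof (induction rule: converse_rtranclp_induct)
  case base
  then show ?case by (intro exI[of _ "[b]"]) auto
next
  case (step y z)
  then obtain p where p: "p \<noteq> []" "hd p = z" "last p = b" "distinct p" "successively R p" by blast
  show ?case
  proof (cases "y \<in> set p")
    case True
    then obtain p1 p2 where "p = p1 @ y # p2" by (auto dest: split_list)
    then show ?thesis using p by (intro exI[of _ "y # p2"]) (auto simp: successively_append_iff)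
  next
    case False
    then show ?thesis using p step by (intro exI[of _ "y # p"]) (auto simp: successively_Cons)
  qed
qed

locale arc_relation =
  fixes V :: "'a set" and E :: "'a \<Rightarrow> 'a \<Rightarrow> bool"
  assumes finite_V [simp]: "finite V"
    and E_V: "E a b \<Longrightarrow> a \<in> V \<and> b \<in> V"
    and E_irrefl [simp]: "\<not> E a a"
begin

definition is_cycle :: "'a list \<Rightarrow> bool" where
  "is_cycle xs \<longleftrightarrow> xs \<noteq> [] \<and> distinct xs \<and> successively E xs \<and> E (last xs) (hd xs)"

text \<open>Degrees count arcs in both directions and are taken relative to a set, so that they add up over
  disjoint sets; they are integers because the counting arguments subtract.\<close>

definition arcs_between :: "'a \<Rightarrow> 'a \<Rightarrow> int" where
  "arcs_between v y = of_bool (E v y) + of_bool (E y v)"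

definition deg :: "'a set \<Rightarrow> 'a \<Rightarrow> int" where
  "deg S v = (\<Sum>y\<in>S. arcs_between v y)"

lemma is_cycle_append:
  assumes "p \<noteq> []" "q \<noteq> []" "distinct p" "distinct q" "set p \<inter> set q = {}"
    "successively E p" "successively E q" "E (last p) (hd q)" "E (last q) (hd p)"
  shows "is_cycle (p @ q)"
  using assms by (auto simp: is_cycle_def successively_append_iff)

lemma arcs_between_le: "arcs_between v y \<le> 2" "0 \<le> arcs_between v y" "arcs_between v v = 0"
  by (auto simp: arcs_between_def)

lemma deg_union: "finite S \<Longrightarrow> finite T \<Longrightarrow> S \<inter> T = {} \<Longrightarrow> deg (S \<union> T) v = deg S v + deg T v"
  by (simp add: deg_def sum.union_disjoint)

lemma deg_le: "finite S \<Longrightarrow> deg S v \<le> 2 * int (card (S - {v}))"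
proof -
  assume fin: "finite S"
  then have "deg S v = (\<Sum>y\<in>S - {v}. arcs_between v y)"
    unfolding deg_def by (intro sum.mono_neutral_right) (auto simp: arcs_between_le)
  also have "\<dots> \<le> (\<Sum>y\<in>S - {v}. 2)" by (intro sum_mono arcs_between_le)
  finally show ?thesis by simp
qed

lemma deg_eq_0: "(\<And>y. y \<in> S \<Longrightarrow> \<not> E v y \<and> \<not> E y v) \<Longrightarrow> deg S v = 0"
  by (simp add: deg_def arcs_between_def)

lemma deg_eq_card:
  assumes "finite S"
  shows "deg S v = int (card {y \<in> S. E v y}) + int (card {y \<in> S. E y v})"
  using assms by (simp add: deg_def arcs_between_def sum.distrib sum.If_cases of_bool_def Int_def)

text \<open>Between consecutive vertices \<open>q\<close>, \<open>q'\<close> of the path at most one of the arcs \<open>qw\<close>, \<open>wq'\<close> is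
  present, which accounts for \<open>length Q - 1\<close> arcs; the arc from \<open>w\<close> to the first vertex and the arc
  from the last vertex to \<open>w\<close> remain. The use is contrapositive: a vertex of larger degree into
  the path can be inserted into it.\<close>

lemma path_insertion_bound:
  assumes "Q \<noteq> []" "distinct Q" "w \<notin> set Q"
    and "\<And>ys a b zs. Q = ys @ a # b # zs \<Longrightarrow> \<not> (E a w \<and> E w b)"
  shows "deg (set Q) w \<le> int (length Q) + of_bool (E (last Q) w)"
proof -
  have "deg (set Q) w \<le> int (length Q) - 1 + of_bool (E w (hd Q)) + of_bool (E (last Q) w)"
    using assms
  proof (induction Q rule: list_nonempty_induct)
    case (single q)
    then show ?case by (simp add: deg_def arcs_between_def)
  next
    case (cons q Q)
    have "deg (set Q) w \<le> int (length Q) - 1 + of_bool (E w (hd Q)) + of_bool (E (last Q) w)"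
      using cons.prems by (intro cons.IH) (auto, metis append_Cons)
    moreover have "deg (set (q # Q)) w = arcs_between w q + deg (set Q) w"
      using cons.prems by (simp add: deg_def)
    moreover have "\<not> (E q w \<and> E w (hd Q))"
      using cons.prems(3)[of "[]" q "hd Q" "tl Q"] cons.hyps by auto
    ultimately show ?case using cons.hyps by (auto simp: arcs_between_def of_bool_def split: if_splits)
  qed
  then show ?thesis by (auto simp: of_bool_def split: if_splits)
qed

text \<open>Indexing a cycle by all integers turns rotation into a shift of the index and spares every
  wrap-around case distinction; injectivity becomes injectivity modulo \<open>m\<close>.\<close>

definition cyclic_sequence :: "int \<Rightarrow> (int \<Rightarrow> 'a) \<Rightarrow> bool" where
  "cyclic_sequence m x \<longleftrightarrow>
     (\<forall>i. E (x i) (x (i + 1))) \<and> (\<forall>i. x (i + m) = x i) \<and> (\<forall>i j. x i = x j \<longrightarrow> m dvd (i - j))"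

lemma cyclic_sequence_of_cycle:
  assumes "is_cycle xs"
  shows "\<exists>x. cyclic_sequence (int (length xs)) x"
proof -
  define l where "l = int (length xs)"
  define x where "x = (\<lambda>i. xs ! nat (i mod l))"
  have l: "0 < l" and dist: "distinct xs" and ne: "xs \<noteq> []"
    using assms by (auto simp: is_cycle_def l_def)
  have bound: "nat (i mod l) < length xs" for i
    using l by (simp add: l_def nat_less_iff)
  have "E (x i) (x (i + 1))" for i
  proof (cases "i mod l = l - 1")
    case True
    then have "(i + 1) mod l = 0" by (metis diff_add_cancel mod_add_left_eq mod_self)
    then have "x (i + 1) = hd xs" using ne by (simp add: x_def hd_conv_nth)
    moreover have "x i = last xs"
      using True ne by (simp add: x_def l_def last_conv_nth nat_diff_distrib')
    ultimately show ?thesis using assms by (simp add: is_cycle_def)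
  next
    case False
    then have less: "i mod l + 1 < l" using l pos_mod_bound[of l i] by linarith
    then have "(i + 1) mod l = i mod l + 1"
      using l by (metis add.commute mod_add_right_eq mod_pos_pos_trivial pos_mod_sign
          add_nonneg_nonneg zero_le_one)
    then have "nat ((i + 1) mod l) = Suc (nat (i mod l))" using l by (simp add: nat_add_distrib)
    moreover have "Suc (nat (i mod l)) < length xs"
      using less l by (simp add: l_def) (metis calculation l_def bound)
    ultimately show ?thesis
      using assms successively_nth[of E xs] by (simp add: x_def is_cycle_def)
  qed
  moreover have "x (i + l) = x i" for i by (simp add: x_def)
  moreover have "l dvd (i - j)" if "x i = x j" for i j
  proof -
    have "nat (i mod l) = nat (j mod l)"
      using that dist bound by (simp add: x_def nth_eq_iff_index_eq)
    then have "i mod l = j mod l" using l by (simp add: nat_eq_iff2 split: if_splits)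
    then show ?thesis by (simp add: mod_eq_dvd_iff)
  qed
  ultimately show ?thesis unfolding cyclic_sequence_def l_def[symmetric] by blast
qed

end

section \<open>Longest non-Hamiltonian cycles\<close>

text \<open>The degree condition of Bang-Jensen, Gutin and Li on non-adjacent vertices with a common
  in-neighbour, together with semi-degrees at least two and the absence of a cycle through all
  but one vertex.\<close>

locale bjgl_digraph = arc_relation +
  assumes strong: "a \<in> V \<Longrightarrow> b \<in> V \<Longrightarrow> E\<^sup>*\<^sup>* a b"
    and two_out: "v \<in> V \<Longrightarrow> 2 \<le> card {y \<in> V. E v y}"
    and two_in: "v \<in> V \<Longrightarrow> 2 \<le> card {y \<in> V. E y v}"
    and dominated_pair: "\<lbrakk>a \<noteq> b; \<not> E a b; \<not> E b a; E z a; E z b\<rbrakk> \<Longrightarrow>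
      2 * int (card V) - 1 \<le> deg V a + deg V b \<and> int (card V) - 1 \<le> deg V a \<and>
      int (card V) - 1 \<le> deg V b"
    and no_prehamiltonian: "is_cycle xs \<Longrightarrow> length xs + 1 \<noteq> card V"
begin

lemma another_out: "v \<in> V \<Longrightarrow> \<exists>y. E v y \<and> y \<noteq> w"
proof (rule ccontr)
  assume "v \<in> V" "\<not> ?thesis"
  then have "{y \<in> V. E v y} \<subseteq> {w}" by auto
  then have "card {y \<in> V. E v y} \<le> 1" using card_mono[of "{w}"] by simp
  then show False using two_out[OF \<open>v \<in> V\<close>] by simp
qed

lemma another_in: "v \<in> V \<Longrightarrow> \<exists>y. E y v \<and> y \<noteq> w"
proof (rule ccontr)
  assume "v \<in> V" "\<not> ?thesis"
  then have "{y \<in> V. E y v} \<subseteq> {w}" by auto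
  then have "card {y \<in> V. E y v} \<le> 1" using card_mono[of "{w}"] by simp
  then show False using two_in[OF \<open>v \<in> V\<close>] by simp
qed

end

text \<open>The cycle \<open>x\<close> of length \<open>m\<close> is longest among the cycles with fewer vertices than the digraph;
  as no cycle has \<open>card V - 1\<close> vertices, at least two vertices lie off it, and every longer cycle
  is Hamiltonian.\<close>

locale longest_cycle = bjgl_digraph +
  fixes m :: int and x :: "int \<Rightarrow> 'a"
  assumes cyclic: "cyclic_sequence m x"
    and m_ge: "2 \<le> m"
    and m_le: "m + 2 \<le> int (card V)"
    and longest: "is_cycle xs \<Longrightarrow> m < int (length xs) \<Longrightarrow> length xs = card V"
begin

lemma x_E [simp]: "E (x i) (x (i + 1))" and x_period: "x (i + m) = x i"
  using cyclic by (auto simp: cyclic_sequence_def)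

lemma x_eq_iff: "x i = x j \<longleftrightarrow> m dvd (i - j)"
proof
  assume "m dvd (i - j)"
  moreover have up: "x (j + m * int k) = x j" for j k
  proof (induction k)
    case (Suc k)
    have "x (j + m * int (Suc k)) = x (j + m * int k + m)" by (simp add: algebra_simps)
    then show ?case using Suc x_period by simp
  qed simp
  moreover have "x (j + m * k) = x j" for j k
    using up[of j "nat k"] up[of "j + m * k" "nat (- k)"] by (cases "0 \<le> k") auto
  ultimately show "x i = x j" by (metis add.commute diff_add_cancel dvdE)
qed (use cyclic in \<open>auto simp: cyclic_sequence_def\<close>)

lemma x_cong: "m dvd (i - j) \<Longrightarrow> x i = x j"
  by (simp add: x_eq_iff)

lemma x_V [simp]: "x i \<in> V"
  using E_V x_E by blast

lemma x_neq: "i < j \<Longrightarrow> j < i + m \<Longrightarrow> x i \<noteq> x j"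
  by (metis x_eq_iff diff_gt_0_iff_gt dvd_diff_commute linorder_not_less zdvd_imp_le
      add.commute diff_less_eq)

lemma inj_on_x: "l < k + m \<Longrightarrow> inj_on x {k..l}"
  by (rule inj_onI) (metis atLeastAtMost_iff linorder_neqE x_neq add_le_cancel_right
      dual_order.strict_trans2 dual_order.strict_trans1)

lemma shift_window: "\<exists>i'. k \<le> i' \<and> i' < k + m \<and> x i' = x i"
  using residue_in_window[of m k i] m_ge x_cong by force

lemma range_x: "range x = x ` {k..k + m - 1}"
proof -
  have "x i \<in> x ` {k..k + m - 1}" for i
    using shift_window[of k i] by (metis atLeastAtMost_iff image_eqI zle_diff1_eq)
  then show ?thesis by auto
qed

lemma card_x_interval: "k \<le> l + 1 \<Longrightarrow> l < k + m \<Longrightarrow> int (card (x ` {k..l})) = l - k + 1"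
  by (simp add: card_image inj_on_x)

definition R :: "'a set" where "R = V - range x"

lemma finite_R [simp]: "finite R" by (simp add: R_def)

lemma R_V: "v \<in> R \<Longrightarrow> v \<in> V" by (simp add: R_def)

lemma x_not_R [simp]: "x i \<notin> R" by (simp add: R_def)

lemma V_split: "V = R \<union> range x" "R \<inter> range x = {}"
  by (auto simp: R_def)

lemma finite_range_x [simp]: "finite (range x)"
  using range_x[of 0] by simp

lemma card_R: "int (card R) = int (card V) - m"
proof -
  have "int (card (range x)) = m"
    using card_x_interval[of 0 "m - 1"] range_x[of 0] m_ge by simp
  then show ?thesis
    using card_Un_disjoint[OF finite_R finite_range_x V_split(2)] V_split(1) by simp
qed

lemma is_cycle_x_path:
  assumes Q: "set Q \<subseteq> range x" "distinct Q" "Q \<noteq> []" "successively E Q"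
    and p: "set p \<subseteq> R" "distinct p" "p \<noteq> []" "successively E p"
    and "E (last Q) (hd p)" "E (last p) (hd Q)"
  shows "is_cycle (Q @ p)"
  using assms V_split(2) by (intro is_cycle_append) auto

lemma length_not_between:
  assumes "is_cycle xs" "m < int (length xs)"
  shows "int (length xs) = int (card V)"
  using longest assms by simp

lemma x_interval_path:
  assumes "k \<le> l" "l < k + m"
  shows "distinct (map x [k..l])" "successively E (map x [k..l])" "map x [k..l] \<noteq> []"
    "hd (map x [k..l]) = x k" "last (map x [k..l]) = x l" "set (map x [k..l]) = x ` {k..l}"
    "int (length (map x [k..l])) = l - k + 1"
proof -
  have "successively E (map x [k..l])"
    using assms(1)
  proof (induction l rule: int_ge_induct)
    case (step i)
    have "[k..i + 1] = [k..i] @ [i + 1]" using step by (simp add: upto_rec2)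
    moreover have "last (map x [k..i]) = x i" using step by (simp add: last_map upto_rec2)
    ultimately show ?case using step by (simp add: successively_append_iff)
  qed simp
  then show "successively E (map x [k..l])" .
  show "distinct (map x [k..l])" using assms by (simp add: distinct_map inj_on_x)
  show "hd (map x [k..l]) = x k" using assms by (subst upto_rec1) auto
  show "last (map x [k..l]) = x l" using assms by (subst upto_rec2) auto
qed (use assms in auto)

definition R_path :: "'a list \<Rightarrow> bool" where
  "R_path p \<longleftrightarrow> p \<noteq> [] \<and> distinct p \<and> set p \<subseteq> R \<and> successively E p"

text \<open>Replacing the \<open>s - 1\<close> vertices of the cycle between \<open>x i\<close> and \<open>x (i + s)\<close> by the path \<open>p\<close> gives a
  cycle with \<open>m - s + 1 + length p\<close> vertices. By the choice of \<open>m\<close> this number is at most \<open>m\<close> or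
  equal to \<open>card V\<close>.\<close>

lemma bypass_length:
  assumes "R_path p" "E (x i) (hd p)" "E (last p) (x (i + s))" "1 \<le> s" "s \<le> m"
  shows "int (length p) < s \<or> int (length p) = int (card V) - m + s - 1"
proof -
  let ?Q = "map x [i + s..i + m]"
  have Q: "distinct ?Q" "successively E ?Q" "?Q \<noteq> []" "hd ?Q = x (i + s)" "last ?Q = x i"
    "int (length ?Q) = m - s + 1"
    using x_interval_path[of "i + s" "i + m"] assms x_period by auto
  have "is_cycle (?Q @ p)"
    using assms Q by (intro is_cycle_x_path) (auto simp: R_path_def)
  moreover have "int (length (?Q @ p)) = m - s + 1 + int (length p)" using Q by simp
  ultimately show ?thesis using length_not_between[of "?Q @ p"] by linarith
qed

end

section \<open>Shortest bypasses\<close>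

context longest_cycle begin

definition R_arc :: "'a \<Rightarrow> 'a \<Rightarrow> bool" where
  "R_arc a b \<longleftrightarrow> E a b \<and> a \<in> R \<and> b \<in> R"

text \<open>The value \<open>s = m\<close>, where the bypass returns to the vertex it left, is admitted: then strong
  connectivity alone provides a bypass.\<close>

definition bypass :: "int \<Rightarrow> int \<Rightarrow> bool" where
  "bypass i s \<longleftrightarrow> (\<exists>a\<in>R. \<exists>b\<in>R. E (x i) a \<and> R_arc\<^sup>*\<^sup>* a b \<and> E b (x (i + s)))"

lemma R_arc_imp_E: "R_arc a b \<Longrightarrow> E a b"
  by (simp add: R_arc_def)

lemma R_path_of_R_arcs:
  assumes "R_arc\<^sup>*\<^sup>* a b" "a \<in> R"
  shows "\<exists>p. R_path p \<and> hd p = a \<and> last p = b"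
proof -
  obtain p where p: "p \<noteq> []" "hd p = a" "last p = b" "distinct p" "successively R_arc p"
    using rtranclp_distinct_path[OF assms(1)] by blast
  have "set q \<subseteq> R" if "q \<noteq> []" "hd q \<in> R" "successively R_arc q" for q
    using that by (induction q rule: list_nonempty_induct) (auto simp: successively_Cons R_arc_def)
  then show ?thesis
    using p assms(2) successively_mono[OF p(5), of E] by (auto simp: R_path_def R_arc_imp_E)
qed

lemma bypass_exists: "\<exists>i s. 1 \<le> s \<and> s \<le> m \<and> bypass i s"
proof -
  have "card R \<noteq> 0" using card_R m_le by linarith
  then obtain v where v: "v \<in> R" by fastforce
  have "\<exists>i. \<exists>a\<in>R. E (x i) a \<and> R_arc\<^sup>*\<^sup>* a v"
  proof -
    have "E\<^sup>*\<^sup>* (x 0) v" using strong v R_V by simp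
    then have "v \<in> R \<longrightarrow> (\<exists>i. \<exists>a\<in>R. E (x i) a \<and> R_arc\<^sup>*\<^sup>* a v)"
    proof (induction rule: rtranclp_induct)
      case (step y z)
      show ?case
      proof
        assume z: "z \<in> R"
        show "\<exists>i. \<exists>a\<in>R. E (x i) a \<and> R_arc\<^sup>*\<^sup>* a z"
        proof (cases "y \<in> R")
          case True
          then have "R_arc y z" using step z by (simp add: R_arc_def)
          then show ?thesis using step True by (meson rtranclp.rtrancl_into_rtrancl)
        next
          case False
          then obtain i where "y = x i" using E_V[OF step(2)] V_split by auto
          then show ?thesis using z step by blast
        qed
      qed
    qed simp
    then show ?thesis using v by blast
  qed
  moreover have "\<exists>j. \<exists>b\<in>R. R_arc\<^sup>*\<^sup>* v b \<and> E b (x j)"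
  proof -
    have "E\<^sup>*\<^sup>* v (x 0)" using strong v R_V by simp
    then have "v \<in> R \<longrightarrow> (\<exists>j. \<exists>b\<in>R. R_arc\<^sup>*\<^sup>* v b \<and> E b (x j))"
    proof (induction rule: converse_rtranclp_induct)
      case (step y z)
      show ?case
      proof
        assume y: "y \<in> R"
        show "\<exists>j. \<exists>b\<in>R. R_arc\<^sup>*\<^sup>* y b \<and> E b (x j)"
        proof (cases "z \<in> R")
          case True
          then have "R_arc y z" using step y by (simp add: R_arc_def)
          then show ?thesis using step True by (meson converse_rtranclp_into_rtranclp)
        next
          case False
          then obtain j where "z = x j" using E_V[OF step(1)] V_split by auto
          then show ?thesis using y step by blast
        qed
      qed
    qed simp
    then show ?thesis using v by blast
  qed
  ultimately obtain i a j b where ab: "a \<in> R" "b \<in> R" "E (x i) a" "R_arc\<^sup>*\<^sup>* a b" "E b (x j)"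
    by (metis rtranclp_trans)
  obtain j' where "i + 1 \<le> j'" "j' < i + 1 + m" "x j' = x j" using shift_window by blast
  then show ?thesis
    using ab by (intro exI[of _ i] exI[of _ "j' - i"]) (auto simp: bypass_def)
qed

lemma map_x_consecutive:
  assumes "map x [k..l] = ys @ a # b # zs"
  shows "\<exists>i. a = x i \<and> b = x (i + 1)"
proof -
  have "length ys + 1 < nat (l - k + 1)"
    using arg_cong[OF assms, of length] by simp
  then have "a = x (k + int (length ys))" "b = x (k + int (length ys) + 1)"
    using arg_cong[OF assms, of "\<lambda>zs. zs ! length ys"]
      arg_cong[OF assms, of "\<lambda>zs. zs ! Suc (length ys)"]
    by (auto simp: nth_append algebra_simps)
  then show ?thesis by blast
qed

text \<open>Suppose that a shortest bypass skips \<open>x 1, \<dots>, x (s - 1)\<close> with \<open>s \<ge> 2\<close>, and let \<open>a\<close> be its first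
  vertex off the cycle. By minimality \<open>a\<close> is not adjacent to a skipped vertex, no path of two arcs
  through \<open>R\<close> joins it to one, and it does not fit between consecutive vertices of the cycle. So
  \<open>a\<close> and a skipped vertex \<open>w\<close> have few arcs into \<open>R\<close> in total and \<open>a\<close> has few arcs to the cycle;
  if their degree sum is large, \<open>w\<close> must have many arcs to the path that runs from \<open>x s\<close> to \<open>x 0\<close>
  along the cycle, and can be inserted into it. Inserting \<open>x 1, x 2, \<dots>\<close> one after the other and
  stopping at the right moment gives a cycle whose length lies strictly between \<open>m\<close> and \<open>card V\<close>.\<close>

lemma shortest_bypass_step_1:
  assumes byp: "bypass 0 s" and s: "1 \<le> s" "s \<le> m"
    and shortest: "\<And>i s'. 1 \<le> s' \<Longrightarrow> s' < s \<Longrightarrow> \<not> bypass i s'"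
  shows "s = 1"
proof (rule ccontr)
  assume "s \<noteq> 1"
  then have s2: "2 \<le> s" using s by simp
  obtain a b where ab: "a \<in> R" "b \<in> R" "E (x 0) a" "R_arc\<^sup>*\<^sup>* a b" "E b (x s)"
    using byp by (auto simp: bypass_def)
  have inj: "inj_on x {1..m}" using inj_on_x[of m 1] by simp
  define arc_end where "arc_end = x ` {s..m}"
  have a_x: "a \<noteq> x j" for j using ab(1) by auto
  have xm: "x m = x 0" using x_period[of 0] by simp
  have nonadj: "\<not> E a (x j)" "\<not> E (x j) a" if "1 \<le> j" "j < s" for j
  proof -
    show "\<not> E a (x j)" using shortest[of j 0] that ab by (auto simp: bypass_def)
    show "\<not> E (x j) a" using shortest[of "s - j" j] that ab s by (auto simp: bypass_def)
  qed
  \<comment> \<open>for every \<open>z\<close> in \<open>R\<close>, each of \<open>x j \<rightarrow> z \<rightarrow> a\<close> and \<open>a \<rightarrow> z \<rightarrow> x j\<close> would yield a shorter bypass\<close>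
  have deg_R: "deg R a + deg R (x j) \<le> 2 * (int (card R) - 1)" if j: "1 \<le> j" "j < s" for j
  proof -
    have two: "arcs_between a z + arcs_between (x j) z \<le> 2" if z: "z \<in> R" for z
    proof -
      have "\<not> (E (x j) z \<and> E z a)"
      proof
        assume "E (x j) z \<and> E z a"
        moreover from this have "R_arc\<^sup>*\<^sup>* z b"
          using ab z by (meson R_arc_def converse_rtranclp_into_rtranclp)
        ultimately have "bypass j (s - j)" using ab z by (auto simp: bypass_def)
        then show False using shortest[of "s - j" j] j by simp
      qed
      moreover have "\<not> (E a z \<and> E z (x j))"
      proof
        assume az: "E a z \<and> E z (x j)"
        then have "R_arc\<^sup>*\<^sup>* a z" using ab z by (auto simp: R_arc_def)
        then have "bypass 0 j" using az ab z by (auto simp: bypass_def)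
        then show False using shortest[of j 0] j by simp
      qed
      ultimately show ?thesis by (auto simp: arcs_between_def)
    qed
    have "deg R a + deg R (x j) = (\<Sum>z\<in>R. arcs_between a z + arcs_between (x j) z)"
      by (simp add: deg_def sum.distrib)
    also have "\<dots> = (\<Sum>z\<in>R - {a}. arcs_between a z + arcs_between (x j) z)"
      using nonadj[OF j] by (intro sum.mono_neutral_right) (auto simp: arcs_between_def)
    also have "\<dots> \<le> (\<Sum>z\<in>R - {a}. 2)" using two by (intro sum_mono) auto
    also have "\<dots> = 2 * (int (card R) - 1)"
    proof -
      have "0 < card R" using ab(1) by (auto simp: card_gt_0_iff)
      then show ?thesis using ab(1) by (simp add: of_nat_diff Suc_leI)
    qed
    finally show ?thesis .
  qed
  note int_path = x_interval_path[of s m]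
  have deg_a_end: "deg arc_end a \<le> m - s + 2"
  proof -
    have "deg (set (map x [s..m])) a \<le> int (length (map x [s..m])) + of_bool (E (last (map x [s..m])) a)"
    proof (rule path_insertion_bound)
      fix ys c d zs
      assume "map x [s..m] = ys @ c # d # zs"
      then obtain i where i: "c = x i" "d = x (i + 1)" using map_x_consecutive by blast
      show "\<not> (E c a \<and> E a d)"
        using shortest[of 1 i] s2 i ab(1) by (auto simp: bypass_def)
    qed (use int_path s ab in auto)
    moreover have "int (length (map x [s..m])) = m - s + 1" using s by simp
    ultimately show ?thesis using int_path(6) s by (auto simp: arc_end_def of_bool_def split: if_splits)
  qed
  have V_parts: "V = R \<union> (arc_end \<union> x ` {1..<s})"
  proof -
    have "{1..m} = {s..m} \<union> {1..<s}" using s by auto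
    then show ?thesis using range_x[of 1] V_split(1) by (simp add: arc_end_def image_Un)
  qed
  have deg_a: "deg V a = deg R a + deg arc_end a"
  proof -
    have "x k \<noteq> x l" if "k \<in> {s..m}" "l \<in> {1..<s}" for k l
      using that x_neq[of l k] by fastforce
    then have "x ` {s..m} \<inter> x ` {1..<s} = {}" by blast
    then have "deg (R \<union> (arc_end \<union> x ` {1..<s})) a = deg R a + (deg arc_end a + deg (x ` {1..<s}) a)"
      using V_split(2) by (subst deg_union) (auto simp: arc_end_def deg_union)
    then have "deg V a = deg R a + (deg arc_end a + deg (x ` {1..<s}) a)"
      using arg_cong[OF V_parts, of "\<lambda>S. deg S a"] by simp
    moreover have "deg (x ` {1..<s}) a = 0" using nonadj by (intro deg_eq_0) auto
    ultimately show ?thesis by simp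
  qed
  have deg_a_ge: "int (card V) - 1 \<le> deg V a"
    using dominated_pair[of a "x 1" "x 0"] nonadj[of 1] s2 ab x_E[of 0] a_x by auto
  \<comment> \<open>\<open>Q\<close> runs from \<open>x s\<close> to \<open>x 0\<close> and has already absorbed \<open>x 1, \<dots>, x j\<close>\<close>
  have absorb: "\<exists>Q. distinct Q \<and> Q \<noteq> [] \<and> set Q = arc_end \<union> x ` {1..int j} \<and> hd Q = x s \<and>
      last Q = x 0 \<and> successively E Q \<and> int (length Q) = m - s + 1 + int j"
    if "int j < s" for j :: nat
    using that
  proof (induction j)
    case 0
    show ?case
      using int_path s xm by (intro exI[of _ "map x [s..m]"]) (auto simp: arc_end_def)
  next
    case (Suc j)
    then obtain Q where Q: "distinct Q" "Q \<noteq> []" "set Q = arc_end \<union> x ` {1..int j}" "hd Q = x s"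
      "last Q = x 0" "successively E Q" "int (length Q) = m - s + 1 + int j"
      by auto
    define w where "w = x (int j + 1)"
    have js: "int j + 1 < s" using Suc by simp
    have Q_image: "set Q = x ` ({s..m} \<union> {1..int j})"
      by (simp add: Q(3) arc_end_def image_Un)
    have w_Q: "w \<notin> set Q"
      unfolding w_def Q_image using js s by (subst inj_on_image_mem_iff[OF inj]) auto
    have "\<exists>ys c d zs. Q = ys @ c # d # zs \<and> E c w \<and> E w d"
    proof (rule ccontr)
      assume no: "\<not> ?thesis"
      have bound: "deg (set Q) w \<le> int (length Q) + of_bool (E (x 0) w)"
        unfolding Q(5)[symmetric] by (rule path_insertion_bound[OF Q(2,1) w_Q]) (use no in blast)
      have deg_w: "deg V w \<le> deg R w + deg (set Q) w + 2 * (s - 2 - int j)"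
      proof -
        have "{1..<s} = {1..int j} \<union> {int j + 1..<s}" using js by auto
        then have V_eq: "V = R \<union> (set Q \<union> x ` {int j + 1..<s})"
          using V_parts unfolding Q(3) by (auto simp: image_Un)
        have "set Q \<inter> x ` {int j + 1..<s} = {}"
          unfolding Q_image using js s by (subst inj_on_image_Int[OF inj, symmetric]) auto
        then have "deg (R \<union> (set Q \<union> x ` {int j + 1..<s})) w
            = deg R w + (deg (set Q) w + deg (x ` {int j + 1..<s}) w)"
          using V_split(2) Q(3) by (subst deg_union) (auto simp: arc_end_def deg_union)
        then have split: "deg V w = deg R w + (deg (set Q) w + deg (x ` {int j + 1..<s}) w)"
          using arg_cong[OF V_eq, of "\<lambda>S. deg S w"] by simp
        have "x ` {int j + 1..<s} - {w} \<subseteq> x ` {int j + 2..<s}"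
          unfolding w_def by (auto simp: image_iff) (metis add.commute atLeastLessThan_iff
              order_le_less zless_imp_add1_zle add.assoc one_add_one)
        then have "card (x ` {int j + 1..<s} - {w}) \<le> card {int j + 2..<s}"
          by (meson card_image_le card_mono finite_atLeastLessThan_int finite_imageI le_trans)
        then have "int (card (x ` {int j + 1..<s} - {w})) \<le> s - 2 - int j" using js by simp
        then have "2 * int (card (x ` {int j + 1..<s} - {w})) \<le> 2 * (s - 2 - int j)"
          by (rule mult_left_mono) simp
        then have "deg (x ` {int j + 1..<s}) w \<le> 2 * (s - 2 - int j)"
          by (rule order_trans[OF deg_le, rotated]) simp
        with split show ?thesis by simp
      qed
      have sum_le: "deg V a + deg V w \<le>
          2 * int (card V) - m + s - 4 - 2 * int j + deg (set Q) w"
        using deg_a deg_a_end deg_w deg_R[of "int j + 1"] js card_R by (simp add: w_def)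
      show False
      proof (cases "E (x 0) w")
        case True
        then have "2 * int (card V) - 1 \<le> deg V a + deg V w"
          using dominated_pair[of a w "x 0"] nonadj[of "int j + 1"] js ab a_x unfolding w_def by auto
        then show False using sum_le bound True Q(7) by simp
      next
        case False
        have j: "1 \<le> int j" using False x_E[of 0] by (cases j) (auto simp: w_def)
        \<comment> \<open>Now \<open>a\<close> and \<open>w\<close> need not have a common in-neighbour. But \<open>x j\<close> lies on \<open>Q\<close> and dominates \<open>w\<close>,
          while the last vertex of \<open>Q\<close> does not, so domination of \<open>w\<close> stops somewhere along \<open>Q\<close>, from
          \<open>c\<close> to \<open>d\<close> say. Then \<open>w\<close> and \<open>d\<close> are non-adjacent with common in-neighbour \<open>c\<close>. This makes
          the degree sum of \<open>a\<close> and \<open>w\<close> only one less than in the other case; and since the last vertex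
          of \<open>Q\<close> does not dominate \<open>w\<close>, one arc less suffices for the insertion.\<close>
        have "x (int j) \<in> set Q" using j Q(3) by auto
        moreover have "E (x (int j)) w" by (simp add: w_def)
        ultimately obtain ys c d zs where split: "Q = ys @ c # d # zs" "E c w" "\<not> E d w"
          using split_at_first_failure[of "x (int j)" Q "\<lambda>c. E c w"] False Q(5) by auto
        then have "\<not> E w d" "E c d" using no Q(6) by (auto simp: successively_append_iff)
        moreover have "w \<noteq> d" using w_Q split by auto
        ultimately have "int (card V) - 1 \<le> deg V w" using dominated_pair[of w d c] split by auto
        then show False using sum_le bound False Q(7) deg_a_ge j by simp
      qed
    qed
    then obtain ys c d zs where split: "Q = ys @ c # d # zs" "E c w" "E w d" by blast
    have "{1..int (Suc j)} = insert (int j + 1) {1..int j}" by auto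
    then have "set (ys @ c # w # d # zs) = arc_end \<union> x ` {1..int (Suc j)}"
      using split Q(3) by (auto simp: w_def)
    moreover have "hd (ys @ c # w # d # zs) = x s" using Q(4) split by (cases ys) auto
    ultimately show ?case
      using split Q w_Q
      by (intro exI[of _ "ys @ c # w # d # zs"]) (auto simp: successively_append_iff)
  qed
  obtain p where p: "R_path p" "hd p = a" "last p = b"
    using R_path_of_R_arcs ab by blast
  have len_p: "1 \<le> int (length p)" "int (length p) \<le> int (card V) - m"
  proof -
    show "1 \<le> int (length p)" using p by (cases p) (auto simp: R_path_def)
    have "length p \<le> card R" using p by (metis R_path_def card_mono distinct_card finite_R)
    then show "int (length p) \<le> int (card V) - m" using card_R by simp
  qed
  \<comment> \<open>If the bypass misses a vertex off the cycle, absorb all skipped vertices; if it contains all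
    of them, absorb all skipped vertices but the last one, for otherwise the cycle would be
    Hamiltonian.\<close>
  define j where "j = (if int (length p) = int (card V) - m then nat (s - 2) else nat (s - 1))"
  have "int j < s" using s2 by (auto simp: j_def)
  then obtain Q where Q: "distinct Q" "Q \<noteq> []" "set Q = arc_end \<union> x ` {1..int j}" "hd Q = x s"
      "last Q = x 0" "successively E Q" "int (length Q) = m - s + 1 + int j"
    using absorb by blast
  have cyc: "is_cycle (Q @ p)"
    using Q p ab by (intro is_cycle_x_path) (auto simp: arc_end_def R_path_def)
  moreover have "m < int (length (Q @ p))" "int (length (Q @ p)) < int (card V)"
    using Q(7) len_p s2 m_le by (auto simp: j_def)
  ultimately show False using length_not_between by fastforce
qed

lemma shift: "longest_cycle V E m (\<lambda>j. x (i + j))"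
proof
  show "cyclic_sequence m (\<lambda>j. x (i + j))"
    using cyclic unfolding cyclic_sequence_def
    by (auto simp: add.assoc[symmetric]) (metis add_diff_cancel_left)
qed (use m_ge m_le longest in auto)

lemma range_shift: "range (\<lambda>j. x (i + j)) = range x"
proof -
  have "x k = x (i + (k - i))" for k by simp
  then show ?thesis by blast
qed

text \<open>A bypass between consecutive vertices of the cycle lengthens it, so it has to produce a
  Hamiltonian cycle.\<close>

lemma spanning_R_path:
  "\<exists>i p. R_path p \<and> set p = R \<and> E (x i) (hd p) \<and> E (last p) (x (i + 1))"
proof -
  define good where "good k \<longleftrightarrow> (\<exists>i. 1 \<le> int k \<and> int k \<le> m \<and> bypass i (int k))" for k
  obtain i0 s0 where "1 \<le> s0" "s0 \<le> m" "bypass i0 s0" using bypass_exists by blast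
  then have "good (nat s0)" by (auto simp: good_def)
  then have "good (LEAST k. good k)" by (rule LeastI)
  then obtain k i where k: "k = (LEAST k. good k)" "1 \<le> int k" "int k \<le> m" "bypass i (int k)"
    by (auto simp: good_def)
  have shortest: "\<not> bypass j s'" if "1 \<le> s'" "s' < int k" for j s'
  proof
    assume "bypass j s'"
    then have "good (nat s')" using that k by (auto simp: good_def)
    then show False using not_less_Least[of "nat s'" good] that k(1) by auto
  qed
  interpret sh: longest_cycle V E m "\<lambda>j. x (i + j)" by (rule shift)
  have R_eq: "sh.R = R" by (simp add: sh.R_def R_def range_shift)
  have arc_eq: "sh.R_arc = R_arc" by (simp add: fun_eq_iff sh.R_arc_def R_arc_def R_eq)
  have bypass_eq: "sh.bypass j s = bypass (i + j) s" for j s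
    by (simp add: sh.bypass_def bypass_def R_eq arc_eq add.assoc)
  have "int k = 1"
    using sh.shortest_bypass_step_1[of "int k"] k shortest by (simp add: bypass_eq)
  then obtain a b where ab: "a \<in> R" "b \<in> R" "E (x i) a" "R_arc\<^sup>*\<^sup>* a b" "E b (x (i + 1))"
    using k by (auto simp: bypass_def)
  obtain p where p: "R_path p" "hd p = a" "last p = b"
    using R_path_of_R_arcs ab by blast
  have "int (length p) = int (card V) - m"
    using bypass_length[of p i 1] p ab m_ge by (auto simp: R_path_def)
  then have "length p = card R" using card_R by simp
  then have "set p = R"
    using p by (intro card_subset_eq) (auto simp: R_path_def distinct_card)
  then show ?thesis using p ab by blast
qed

end

section \<open>Neighbours on the cycle of a vertex off the cycle\<close>

context longest_cycle begin

lemma not_insertable: "v \<in> R \<Longrightarrow> \<not> (E (x (i - 1)) v \<and> E v (x i))"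
  using bypass_length[of "[v]" "i - 1" 1] m_ge m_le by (auto simp: R_path_def)

text \<open>Every slot \<open>j\<close> of the cycle offers a vertex \<open>v\<close> off the cycle the two arcs from \<open>x (j - 1)\<close> and to
  \<open>x j\<close>, of which it can have at most one, as \<open>v\<close> cannot be inserted there. So the degree of \<open>v\<close> into
  the cycle is at most \<open>m\<close>, and it falls short of \<open>m\<close> by the number of slots where \<open>v\<close> has neither.\<close>

definition missed :: "'a \<Rightarrow> int \<Rightarrow> bool" where
  "missed v j \<longleftrightarrow> \<not> E (x (j - 1)) v \<and> \<not> E v (x j)"

lemma deg_range_x:
  "deg (range x) v = (\<Sum>j\<in>{0..m - 1}. of_bool (E (x (j - 1)) v) + of_bool (E v (x j)))"
proof -
  have "bij_betw (\<lambda>j. x (j - 1)) {0..m - 1} (range x)"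
  proof -
    have "bij_betw (\<lambda>j. j - 1) {0..m - 1} {-1..m - 2}"
      by (rule bij_betw_byWitness[where f' = "\<lambda>j. j + 1"]) auto
    moreover have "bij_betw x {-1..m - 2} (range x)"
      using inj_on_x[of "m - 2" "-1"] range_x[of "-1"] by (auto simp: bij_betw_def)
    ultimately show ?thesis using bij_betw_trans by (fastforce simp: comp_def)
  qed
  then have "(\<Sum>j\<in>{0..m - 1}. of_bool (E (x (j - 1)) v)) = (\<Sum>y\<in>range x. (of_bool (E y v) :: int))"
    by (rule sum.reindex_bij_betw)
  moreover have "bij_betw x {0..m - 1} (range x)"
    using inj_on_x[of "m - 1" 0] range_x[of 0] by (auto simp: bij_betw_def)
  then have "(\<Sum>j\<in>{0..m - 1}. of_bool (E v (x j))) = (\<Sum>y\<in>range x. (of_bool (E v y) :: int))"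
    by (rule sum.reindex_bij_betw)
  ultimately show ?thesis by (simp add: deg_def arcs_between_def sum.distrib)
qed

lemma deg_range_x_missed:
  assumes "v \<in> R" "S \<subseteq> {0..m - 1}" "\<And>j. j \<in> S \<Longrightarrow> missed v j"
  shows "deg (range x) v \<le> m - int (card S)"
proof -
  let ?f = "\<lambda>j. of_bool (E (x (j - 1)) v) + of_bool (E v (x j)) :: int"
  have "deg (range x) v = (\<Sum>j\<in>{0..m - 1} - S. ?f j)"
    unfolding deg_range_x using assms by (intro sum.mono_neutral_right) (auto simp: missed_def)
  also have "\<dots> \<le> (\<Sum>j\<in>{0..m - 1} - S. 1)"
    using not_insertable[OF assms(1)] by (intro sum_mono) auto
  also have "\<dots> = int (card {0..m - 1}) - int (card S)"
    using assms(2) card_mono[OF _ assms(2)] by (simp add: card_Diff_subset finite_subset of_nat_diff)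
  finally show ?thesis using m_ge by simp
qed

lemma deg_range_x_le: "v \<in> R \<Longrightarrow> deg (range x) v \<le> m"
  using deg_range_x_missed[of v "{}"] by simp

lemma missed_cong: "m dvd (i - j) \<Longrightarrow> missed v i = missed v j"
proof -
  assume "m dvd (i - j)"
  then have "x i = x j" "x (i - 1) = x (j - 1)" by (auto simp: x_eq_iff)
  then show ?thesis by (simp add: missed_def)
qed

lemma window_0: "\<exists>j'. 0 \<le> j' \<and> j' \<le> m - 1 \<and> m dvd (j' - j)"
  using residue_in_window[of m 0 j] m_ge by force

lemma missed_deg: "v \<in> R \<Longrightarrow> missed v j \<Longrightarrow> deg (range x) v \<le> m - 1"
proof -
  assume "v \<in> R" "missed v j"
  moreover obtain j' where "0 \<le> j'" "j' \<le> m - 1" "m dvd (j' - j)" using window_0 by blast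
  ultimately show ?thesis using deg_range_x_missed[of v "{j'}"] missed_cong by auto
qed

lemma missed_unique:
  assumes v: "v \<in> R" and deg: "m - 1 \<le> deg (range x) v" and ij: "missed v i" "missed v j"
  shows "m dvd (i - j)"
proof -
  obtain i' j' where w: "0 \<le> i'" "i' \<le> m - 1" "m dvd (i' - i)" "0 \<le> j'" "j' \<le> m - 1" "m dvd (j' - j)"
    using window_0 by meson
  have "i' = j'"
  proof (rule ccontr)
    assume "i' \<noteq> j'"
    then show False
      using deg_range_x_missed[OF v, of "{i', j'}"] w ij missed_cong deg by auto
  qed
  then have "m dvd (i' - j)" using w by simp
  then have "m dvd ((i' - j) - (i' - i))" using w(3) by (rule dvd_diff)
  then show ?thesis by simp
qed

lemma deg_V: "deg V v = deg R v + deg (range x) v"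
  using deg_union[of R "range x" v] V_split by simp

lemma periodic_in: "periodic_predicate (\<lambda>j. E (x (j - 1)) v) m"
proof
  fix i j assume "m dvd (i - j)"
  then have "x (i - 1) = x (j - 1)" by (simp add: x_eq_iff)
  then show "E (x (i - 1)) v = E (x (j - 1)) v" by simp
qed (use m_ge in simp)

text \<open>Where domination of \<open>v\<close> along the cycle stops, \<open>v\<close> is not adjacent to the next vertex of the cycle
  and has a common in-neighbour with it.\<close>

lemma end_pair:
  assumes "v \<in> R" "E (x (a - 1)) v" "\<not> E (x a) v"
  shows "\<not> E v (x a)" "2 * int (card V) - 1 \<le> deg V v + deg V (x a)"
    "int (card V) - 1 \<le> deg V v" "int (card V) - 1 \<le> deg V (x a)"
proof -
  show "\<not> E v (x a)" using not_insertable assms by blast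
  moreover have "v \<noteq> x a" using assms(1) by auto
  ultimately show "2 * int (card V) - 1 \<le> deg V v + deg V (x a)"
    "int (card V) - 1 \<le> deg V v" "int (card V) - 1 \<le> deg V (x a)"
    using dominated_pair[of v "x a" "x (a - 1)"] assms x_E[of "a - 1"] by auto
qed

lemma deg_ge:
  assumes "v \<in> R" "E (x k) v" "E v (x j)"
  shows "int (card V) - 1 \<le> deg V v"
proof -
  interpret periodic_predicate "\<lambda>j. E (x (j - 1)) v" m by (rule periodic_in)
  have "\<exists>i. E (x (i - 1)) v \<and> \<not> E (x (i + 1 - 1)) v"
    using end_exists[of "k + 1" j] not_insertable assms by auto
  then show ?thesis using end_pair assms by auto
qed

end

section \<open>Exactly two vertices lie off the cycle\<close>

locale spanned_longest_cycle = longest_cycle +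
  fixes i :: int and u w :: 'a and qs :: "'a list"
  assumes R_path: "R_path (u # qs @ [w])" and spans: "R = insert u (insert w (set qs))"
    and into_u: "E (x i) u" and out_of_w: "E w (x (i + 1))"
begin

lemma card_R_eq: "card R = length qs + 2"
proof -
  have "set (u # qs @ [w]) = R" using spans by auto
  then show ?thesis using R_path distinct_card[of "u # qs @ [w]"] by (simp add: R_path_def)
qed

lemma no_shortcut:
  assumes "R_path q" "hd q = u" "last q = w"
  shows "length q = length qs + 2"
proof -
  have "1 \<le> length q" using assms by (cases q) (auto simp: R_path_def)
  moreover have "int (length q) < 1 \<or> int (length q) = int (card V) - m"
    using bypass_length[of q i 1] assms into_u out_of_w m_ge by simp
  ultimately show ?thesis using card_R card_R_eq by linarith
qed

text \<open>A second arc from \<open>u\<close> within \<open>R\<close> would skip a vertex of the spanning path, which is impossible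
  for a bypass between consecutive vertices of the cycle.\<close>

lemma u_out:
  assumes "E u y" "y \<in> R"
  shows "y = hd (qs @ [w])"
proof -
  have "y \<in> set (qs @ [w])" using assms spans by auto
  then obtain as bs where split: "qs @ [w] = as @ y # bs" by (meson split_list)
  have path: "R_path (u # as @ y # bs)" using R_path unfolding split .
  then have "R_path (u # y # bs)"
    using assms by (cases bs) (auto simp: R_path_def successively_append_iff successively_Cons)
  moreover have "last (u # y # bs) = w"
    using arg_cong[OF split, of last] by simp
  ultimately have "length (u # y # bs) = length qs + 2" by (intro no_shortcut) auto
  then have "as = []" using arg_cong[OF split, of length] by simp
  then show ?thesis unfolding split by simp
qed

lemma w_in:
  assumes "E y w" "y \<in> R"
  shows "y = last (u # qs)"
proof -
  have "y \<in> set (u # qs)" using assms spans by auto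
  then obtain as bs where split: "u # qs = as @ y # bs" by (meson split_list)
  have eq: "u # qs @ [w] = as @ y # bs @ [w]" using split by (metis append_Cons append_assoc)
  have "R_path (as @ y # bs @ [w])" using R_path unfolding eq .
  then have "R_path (as @ [y, w])"
    using assms by (auto simp: R_path_def successively_append_iff successively_Cons)
  moreover have "hd (as @ [y, w]) = u" using arg_cong[OF split, of hd] by (cases as) auto
  ultimately have "length (as @ [y, w]) = length qs + 2" by (intro no_shortcut) auto
  then have "bs = []" using arg_cong[OF split, of length] by simp
  then show ?thesis unfolding split by simp
qed

lemma uw_R: "u \<in> R" "w \<in> R" "u \<noteq> w"
  using spans R_path by (auto simp: R_path_def)

lemma deg_R_u: "deg R u \<le> 1 + int (card {y \<in> R. E y u})"
proof -
  have "{y \<in> R. E u y} \<subseteq> {hd (qs @ [w])}" using u_out by auto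
  then have "card {y \<in> R. E u y} \<le> 1" using card_mono[of "{hd (qs @ [w])}"] by simp
  then show ?thesis using deg_eq_card[of R u] by simp
qed

lemma deg_R_w: "deg R w \<le> 1 + int (card {y \<in> R. E w y})"
proof -
  have "{y \<in> R. E y w} \<subseteq> {last (u # qs)}" using w_in by auto
  then have "card {y \<in> R. E y w} \<le> 1" using card_mono[of "{last (u # qs)}"] by simp
  then show ?thesis using deg_eq_card[of R w] by simp
qed

lemma u_out_x: "\<exists>j. E u (x j)"
proof -
  obtain y where "E u y" "y \<noteq> hd (qs @ [w])" using another_out uw_R R_V by blast
  then have "y \<notin> R" "y \<in> V" using u_out E_V by auto
  then show ?thesis using V_split \<open>E u y\<close> by auto
qed

lemma w_in_x: "\<exists>j. E (x j) w"
proof -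
  obtain y where "E y w" "y \<noteq> last (u # qs)" using another_in uw_R R_V by blast
  then have "y \<notin> R" "y \<in> V" using w_in E_V by auto
  then show ?thesis using V_split \<open>E y w\<close> by auto
qed

lemma deg_u_ge: "int (card V) - 1 \<le> deg V u"
  using deg_ge[of u i] uw_R u_out_x into_u by auto

lemma deg_w_ge: "int (card V) - 1 \<le> deg V w"
  using deg_ge[of w _ "i + 1"] uw_R w_in_x out_of_w by auto

text \<open>Otherwise \<open>u\<close> and \<open>w\<close> are non-adjacent, both have degree exactly \<open>card V - 1\<close>, and reaching this
  degree forces the predecessor of \<open>w\<close> on the path, which dominates \<open>w\<close>, to dominate \<open>u\<close> as well.
  This is too little for a pair with a common in-neighbour.\<close>

lemma w_dominates_u:
  assumes "3 \<le> card R"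
  shows "E w u"
proof (rule ccontr)
  assume no: "\<not> E w u"
  have qs: "qs \<noteq> []" using assms card_R_eq by auto
  have "\<not> E u w"
  proof
    assume "E u w"
    then have "w = hd qs" using u_out uw_R qs by auto
    then show False using R_path qs hd_in_set[OF qs] by (auto simp: R_path_def)
  qed
  define z where "z = last qs"
  have z: "z \<in> R" "z \<noteq> u" "z \<noteq> w" "E z w"
    using R_path qs last_in_set[OF qs] spans
    by (auto simp: R_path_def z_def successively_append_iff successively_Cons)
  have card_less: "int (card (R - {u, w})) = int (card R) - 2"
    using uw_R assms by (simp add: card_Diff_subset of_nat_diff)
  have sub_u: "{y \<in> R. E y u} \<subseteq> R - {u, w}" and sub_w: "{y \<in> R. E w y} \<subseteq> R - {u, w}"
    using no \<open>\<not> E u w\<close> by auto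
  have "card {y \<in> R. E y u} \<le> card (R - {u, w})" "card {y \<in> R. E w y} \<le> card (R - {u, w})"
    using sub_u sub_w by (auto intro!: card_mono)
  then have deg_le: "deg V u \<le> int (card V) - 1" "deg V w \<le> int (card V) - 1"
    using deg_R_u deg_R_w deg_V[of u] deg_V[of w] deg_range_x_le[of u] deg_range_x_le[of w] uw_R
      card_less card_R by linarith+
  have "E z u"
  proof (rule ccontr)
    assume "\<not> E z u"
    then have "{y \<in> R. E y u} \<subset> R - {u, w}" using sub_u z by auto
    then have "card {y \<in> R. E y u} < card (R - {u, w})" by (intro psubset_card_mono) auto
    then show False
      using deg_R_u deg_V[of u] deg_range_x_le[of u] uw_R card_less card_R deg_u_ge by linarith
  qed
  then show False
    using dominated_pair[of u w z] z no \<open>\<not> E u w\<close> uw_R deg_le by linarith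
qed

text \<open>If three or more vertices lie off the cycle, the arc from \<open>w\<close> to \<open>u\<close> and the spanning path from
  \<open>u\<close> to \<open>w\<close> forbid several distances between a vertex that dominates \<open>u\<close> or \<open>w\<close> and a vertex
  dominated by \<open>w\<close> or \<open>u\<close>. As \<open>u\<close> and \<open>w\<close> miss at most one slot each, two consecutive slots without
  an arc from the cycle to \<open>u\<close> or \<open>w\<close> would make all earlier slots of this kind, and then \<open>u\<close> and \<open>w\<close>
  would have no in-neighbours on the cycle. Following the slots backwards from \<open>i + 1\<close> leads to such a pair
  unless \<open>m = 3\<close>, and in that case a cycle of length four appears.\<close>

lemma card_R_eq_2: "card R = 2"
proof (rule ccontr)
  assume "card R \<noteq> 2"
  then have r3: "3 \<le> card R" using card_R_eq by (cases qs) auto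
  then have qs: "qs \<noteq> []" using card_R_eq by auto
  have wu: "E w u" by (rule w_dominates_u[OF r3])
  have n: "int (card V) = m + int (card R)" using card_R by simp
  have m_r: "int (card R) \<le> m"
  proof (rule ccontr)
    assume less: "\<not> int (card R) \<le> m"
    have "is_cycle (u # qs @ [w])" using R_path wu by (auto simp: is_cycle_def R_path_def)
    then have "int (length (u # qs @ [w])) = int (card V)"
      using less card_R_eq by (intro length_not_between) auto
    then show False using n m_ge card_R_eq by simp
  qed
  \<comment> \<open>\<open>A\<close> and \<open>B\<close> record the slots with an arc to \<open>u\<close> and \<open>w\<close>, \<open>O_u\<close> and \<open>O_w\<close> those with an arc from them\<close>
  define A where "A j = E (x (j - 1)) u" for j
  define B where "B j = E (x (j - 1)) w" for j
  define O_u where "O_u j = E u (x j)" for j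
  define O_w where "O_w j = E w (x j)" for j
  have A_Ou: "\<not> (A j \<and> O_u j)" and B_Ow: "\<not> (B j \<and> O_w j)" for j
    using not_insertable uw_R by (auto simp: A_def B_def O_u_def O_w_def)
  have wu_path: "R_path [w, u]" using wu uw_R by (auto simp: R_path_def)
  have B_Ou: "\<not> (B j \<and> O_u j)" "\<not> (B j \<and> O_u (j + 1))" for j
    using bypass_length[OF wu_path, of "j - 1" 1] bypass_length[OF wu_path, of "j - 1" 2] m_ge n r3
    by (auto simp: B_def O_u_def add.commute)
  have A_Ow: "\<not> (A j \<and> O_w (j + 1))" "\<not> (A j \<and> O_w (j + 2))" for j
    using bypass_length[OF R_path, of "j - 1" 2] bypass_length[OF R_path, of "j - 1" 3] m_r r3 n
      card_R_eq
    by (auto simp: A_def O_w_def add.commute)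
  have deg_x: "m - 1 \<le> deg (range x) u" "m - 1 \<le> deg (range x) w"
  proof -
    have "{y \<in> R. E y u} \<subseteq> R - {u}" "{y \<in> R. E w y} \<subseteq> R - {w}" by auto
    then have "card {y \<in> R. E y u} \<le> card (R - {u})" "card {y \<in> R. E w y} \<le> card (R - {w})"
      by (auto intro!: card_mono)
    then have "int (card {y \<in> R. E y u}) \<le> int (card R) - 1"
      "int (card {y \<in> R. E w y}) \<le> int (card R) - 1"
      using uw_R r3 by (auto simp: of_nat_diff)
    then show "m - 1 \<le> deg (range x) u" "m - 1 \<le> deg (range x) w"
      using deg_R_u deg_R_w deg_u_ge deg_w_ge deg_V[of u] deg_V[of w] n by linarith+
  qed
  have miss_u: "m dvd (k - l)" if "\<not> A k" "\<not> O_u k" "\<not> A l" "\<not> O_u l" for k l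
    using missed_unique[of u k l] that uw_R deg_x by (auto simp: missed_def A_def O_u_def)
  have miss_w: "m dvd (k - l)" if "\<not> B k" "\<not> O_w k" "\<not> B l" "\<not> O_w l" for k l
    using missed_unique[of w k l] that uw_R deg_x by (auto simp: missed_def B_def O_w_def)
  have no_dvd_1: "\<not> m dvd 1" using m_ge by auto
  have A_e: "A (i + 1)" and Ow_e: "O_w (i + 1)"
    using into_u out_of_w by (auto simp: A_def O_w_def add.commute)
  have covered: "A j \<or> B j \<or> A (j + 1) \<or> B (j + 1)" for j
  proof (rule ccontr)
    assume no: "\<not> ?thesis"
    interpret periodic_predicate "\<lambda>j. \<not> A j \<and> \<not> B j" m
    proof
      fix k l assume "m dvd (k - l)"
      then have "x (k - 1) = x (l - 1)" by (simp add: x_eq_iff)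
      then show "(\<not> A k \<and> \<not> B k) = (\<not> A l \<and> \<not> B l)" by (simp add: A_def B_def)
    qed (use m_ge in simp)
    have "\<not> A (i + 1) \<and> \<not> B (i + 1)"
    proof (rule downward_everywhere)
      fix k assume k: "\<not> A (k + 1) \<and> \<not> B (k + 1)" "\<not> A (k + 2) \<and> \<not> B (k + 2)"
      then have "O_w (k + 1) \<or> O_w (k + 2)"
        using miss_w[of "k + 2" "k + 1"] no_dvd_1 by auto
      then have "\<not> A k" using A_Ow by blast
      moreover have "O_u k \<or> O_u (k + 1)"
        using miss_u[of "k + 1" k] no_dvd_1 k \<open>\<not> A k\<close> by auto
      then have "\<not> B k" using B_Ou by blast
      ultimately show "\<not> A k \<and> \<not> B k" by blast
    qed (use no in auto)
    then show False using A_e by blast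
  qed
  have s: "i + 1 - 1 = i" "i - 1 + 1 = i" "i - 1 + 2 = i + 1" "i - 2 + 1 = i - 1" "i - 2 + 2 = i"
    "i - 3 + 1 = i - 2" "i - 3 + 2 = i - 1" "i - 4 + 1 = i - 3" "i - 4 + 2 = i - 2" by auto
  have 1: "\<not> B (i + 1)" "\<not> A i" "\<not> A (i - 1)"
    using B_Ow[of "i + 1"] A_Ow[of i] A_Ow[of "i - 1"] Ow_e s by auto
  have 2: "\<not> O_u i"
  proof
    assume "O_u i"
    then have "\<not> B i" "\<not> B (i - 1)" using B_Ou(1)[of i] B_Ou(2)[of "i - 1"] s by auto
    then show False using covered[of "i - 1"] 1 s by auto
  qed
  have 3: "O_u (i - 1)" using miss_u[of i "i - 1"] 1 2 no_dvd_1 by auto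
  then have 4: "\<not> B (i - 1)" "\<not> B (i - 2)" using B_Ou(1)[of "i - 1"] B_Ou(2)[of "i - 2"] s by auto
  have 5: "B i" "A (i - 2)" using covered[of "i - 1"] covered[of "i - 2"] 1 4 s by auto
  have 6: "\<not> O_w (i - 1)" using A_Ow(1)[of "i - 2"] 5 s by auto
  have 7: "O_w (i - 2)" using miss_w[of "i - 1" "i - 2"] 4 6 no_dvd_1 by auto
  have 8: "\<not> A (i - 3)" "\<not> A (i - 4)" using A_Ow[of "i - 3"] A_Ow[of "i - 4"] 7 s by auto
  have m3: "m = 3"
  proof (rule ccontr)
    assume "m \<noteq> 3"
    then have "\<not> m dvd 3" using m_r r3 by (auto dest: zdvd_imp_le)
    then have "O_u (i - 3)" using miss_u[of i "i - 3"] 1 2 8 by auto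
    then have "\<not> B (i - 3)" "\<not> B (i - 4)" using B_Ou(1)[of "i - 3"] B_Ou(2)[of "i - 4"] s by auto
    then show False using covered[of "i - 4"] 8 s by auto
  qed
  define z where "z = hd qs"
  have z: "z \<in> R" "z \<noteq> u" "z \<noteq> w"
    using R_path qs hd_in_set[OF qs] spans by (auto simp: R_path_def z_def)
  have "E z u"
  proof (rule ccontr)
    assume "\<not> E z u"
    then have "{y \<in> R. E y u} \<subseteq> R - {u, z}" by auto
    then have "card {y \<in> R. E y u} \<le> card (R - {u, z})" by (intro card_mono) auto
    also have "\<dots> = card R - 2" using z uw_R by (simp add: card_Diff_subset)
    finally have "deg R u \<le> int (card R) - 1" using deg_R_u r3 by linarith
    moreover have "deg (range x) u \<le> m - 1"
      using missed_deg[of u i] uw_R 1 2 by (simp add: missed_def A_def O_u_def)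
    ultimately show False using deg_u_ge deg_V[of u] n by linarith
  qed
  moreover have "E w z"
  proof (rule ccontr)
    assume "\<not> E w z"
    then have "{y \<in> R. E w y} \<subseteq> R - {w, z}" by auto
    then have "card {y \<in> R. E w y} \<le> card (R - {w, z})" by (intro card_mono) auto
    also have "\<dots> = card R - 2" using z uw_R by (simp add: card_Diff_subset)
    finally have "deg R w \<le> int (card R) - 1" using deg_R_w r3 by linarith
    moreover have "deg (range x) w \<le> m - 1"
      using missed_deg[of w "i - 1"] uw_R 4 6 by (simp add: missed_def B_def O_w_def)
    ultimately show False using deg_w_ge deg_V[of w] n by linarith
  qed
  moreover have "E u (x (i - 1))" "E (x (i - 1)) w"
    using 3 5 by (auto simp: O_u_def B_def)
  ultimately have "is_cycle [u, x (i - 1), w, z]"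
    using uw_R z by (auto simp: is_cycle_def)
  then have "int (length [u, x (i - 1), w, z]) = int (card V)"
    using m3 by (intro length_not_between) auto
  then show False using n m3 r3 by simp
qed

end

section \<open>The cycle with the heaviest complement\<close>

context longest_cycle begin

lemma two_vertices_outside:
  "\<exists>u w. u \<noteq> w \<and> R = {u, w} \<and> E u w \<and>
    (\<exists>k. E (x k) u) \<and> (\<exists>k. E u (x k)) \<and> (\<exists>k. E (x k) w) \<and> (\<exists>k. E w (x k))"
proof -
  obtain i p where p: "R_path p" "set p = R" "E (x i) (hd p)" "E (last p) (x (i + 1))"
    using spanning_R_path by blast
  have "length p = card R" using p by (metis R_path_def distinct_card)
  then have "2 \<le> length p" using card_R m_le by linarith
  then obtain u ps where ps: "p = u # ps" "ps \<noteq> []" by (cases p) force+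
  define qs where "qs = butlast ps"
  define w where "w = last ps"
  have p_eq: "p = u # qs @ [w]" using ps by (simp add: qs_def w_def)
  interpret spanned_longest_cycle V E m x i u w qs
    using p unfolding p_eq by unfold_locales auto
  have "qs = []" using card_R_eq_2 card_R_eq by simp
  then show ?thesis
    using spans R_path uw_R u_out_x w_in_x into_u out_of_w
    by (intro exI[of _ u] exI[of _ w]) (auto simp: R_path_def)
qed

lemma card_V_eq: "int (card V) = m + 2"
proof -
  obtain u w where "u \<noteq> w" "R = {u, w}" using two_vertices_outside by blast
  then show ?thesis using card_R by simp
qed

definition replace :: "int \<Rightarrow> 'a \<Rightarrow> int \<Rightarrow> 'a" where
  "replace k a j = (if m dvd (j - k) then a else x j)"

lemma cyclic_sequence_replace:
  assumes a: "a \<in> R" "E (x (k - 1)) a" "E a (x (k + 1))"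
  shows "cyclic_sequence m (replace k a)"
  unfolding cyclic_sequence_def
proof (intro conjI allI impI)
  fix i
  show "E (replace k a i) (replace k a (i + 1))"
  proof (cases "m dvd (i - k)")
    case True
    have "\<not> m dvd (i + 1 - k)"
    proof
      assume "m dvd (i + 1 - k)"
      then have "m dvd ((i + 1 - k) - (i - k))" using True by (rule dvd_diff)
      then show False using m_ge by simp
    qed
    moreover have "x (i + 1) = x (k + 1)" using True by (simp add: x_eq_iff)
    ultimately show ?thesis using True a by (simp add: replace_def)
  next
    case False
    show ?thesis
    proof (cases "m dvd (i + 1 - k)")
      case True
      then have "x i = x (k - 1)" by (simp add: x_eq_iff algebra_simps)
      then show ?thesis using True False a by (simp add: replace_def)
    next
      case 2: False
      then show ?thesis using False by (simp add: replace_def)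
    qed
  qed
next
  fix i
  have "m dvd (i + m - k) \<longleftrightarrow> m dvd (i - k)"
    by (metis add_diff_eq diff_add_eq dvd_add_left_iff dvd_refl)
  then show "replace k a (i + m) = replace k a i" by (simp add: replace_def x_period)
next
  fix i j
  assume eq: "replace k a i = replace k a j"
  show "m dvd (i - j)"
  proof (cases "m dvd (i - k)")
    case True
    then have "m dvd (j - k)" using eq a(1) by (auto simp: replace_def split: if_splits)
    with True have "m dvd ((i - k) - (j - k))" by (rule dvd_diff)
    then show ?thesis by simp
  next
    case False
    then have "x i = x j" using eq a(1) by (auto simp: replace_def split: if_splits)
    then show ?thesis by (simp add: x_eq_iff)
  qed
qed

lemma outside_replace:
  assumes "a \<in> R"
  shows "V - range (replace k a) = insert (x k) (R - {a})"
proof -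
  have "range (replace k a) = insert a (range x - {x k})"
  proof (intro equalityI subsetI)
    fix y assume "y \<in> range (replace k a)"
    then show "y \<in> insert a (range x - {x k})" by (auto simp: replace_def x_eq_iff)
  next
    fix y assume y: "y \<in> insert a (range x - {x k})"
    show "y \<in> range (replace k a)"
    proof (cases "y = a")
      case True
      then have "y = replace k a k" by (simp add: replace_def)
      then show ?thesis by blast
    next
      case False
      then obtain j where "y = x j" "x j \<noteq> x k" using y by auto
      then have "y = replace k a j" by (simp add: replace_def x_eq_iff)
      then show ?thesis by blast
    qed
  qed
  then show ?thesis using assms by (auto simp: R_def)
qed

end

text \<open>Among the cycles of length \<open>m\<close> take one whose complement has the largest degree sum: exchanging
  a vertex off the cycle for one on it never increases the degree.\<close>

locale heaviest_outside = longest_cycle +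
  assumes heaviest: "cyclic_sequence m y \<Longrightarrow> (\<Sum>z\<in>V - range y. deg V z) \<le> (\<Sum>z\<in>R. deg V z)"
begin

text \<open>If \<open>a\<close> can take the place of \<open>x k\<close>, the choice of the cycle gives \<open>deg V (x k) \<le> deg V a\<close>, whereas
  the two degrees sum to at least \<open>2 * card V - 1\<close>.\<close>

lemma replaceable_end:
  assumes a: "a \<in> R" "E (x (k - 1)) a" "\<not> E (x k) a" "E a (x (k + 1))"
  shows "int (card V) \<le> deg V a"
proof -
  have "(\<Sum>z\<in>insert (x k) (R - {a}). deg V z) \<le> (\<Sum>z\<in>R. deg V z)"
    using heaviest[OF cyclic_sequence_replace[OF a(1,2,4)]] outside_replace[OF a(1)] by simp
  moreover have "(\<Sum>z\<in>R. deg V z) = deg V a + (\<Sum>z\<in>R - {a}. deg V z)"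
    using a by (intro sum.remove) auto
  ultimately have "deg V (x k) \<le> deg V a" by simp
  then show ?thesis using end_pair(2)[of a k] a by simp
qed

text \<open>Without the arc \<open>ba\<close> the vertex \<open>a\<close> could reach degree \<open>card V - 1\<close> only by missing no slot. Then
  every end is replaceable, which requires degree \<open>card V\<close>.\<close>

lemma both_directions:
  assumes R: "R = {a, b}" "a \<noteq> b" and "E a b" and a: "E (x k) a" "E a (x j)"
  shows "E b a"
proof (rule ccontr)
  assume no: "\<not> E b a"
  have aR: "a \<in> R" using R by simp
  have "deg R a = 1" using R no \<open>E a b\<close> by (simp add: deg_def arcs_between_def)
  then have eq: "deg V a = deg (range x) a + 1" by (simp add: deg_V)
  have ge: "int (card V) - 1 \<le> deg V a" using deg_ge[OF aR a] .
  then have full: "m \<le> deg (range x) a" using eq card_V_eq by simp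
  interpret periodic_predicate "\<lambda>j. E (x (j - 1)) a" m by (rule periodic_in)
  obtain l where l: "E (x (l - 1)) a" "\<not> E (x l) a"
    using end_exists[of "k + 1" j] not_insertable aR a by auto
  have "\<not> missed a (l + 1)" using missed_deg[OF aR, of "l + 1"] full by auto
  then have "E a (x (l + 1))" using l by (simp add: missed_def)
  then have "int (card V) \<le> deg V a" using replaceable_end[OF aR l] by simp
  then show False using eq deg_range_x_le[OF aR] card_V_eq by simp
qed

text \<open>Suppose that \<open>a\<close> has degree \<open>card V - 1\<close> only. It misses one slot, and an end of its
  in-neighbourhood that is not followed by the missed slot would be replaceable; so there is only
  one end \<open>k\<close> and \<open>k + 1\<close> is missed. The arcs between \<open>a\<close> and \<open>b\<close> make \<open>b\<close> miss the same slot and end at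
  the same place. Thus \<open>x k\<close> is adjacent to neither of them and has degree at least \<open>card V\<close>, so
  that it can be inserted into the path from \<open>x (k + 2)\<close> to \<open>x (k - 1)\<close>; closing this path through
  \<open>a\<close> and \<open>b\<close> loses only \<open>x (k + 1)\<close>.\<close>

lemma outside_full_degree:
  assumes R: "R = {a, b}" "a \<noteq> b" and ab: "E a b" "E b a"
    and a: "E (x ka) a" "E a (x ja)" and b: "E (x kb) b" "E b (x jb)"
  shows "deg V a = int (card V)"
proof (rule ccontr)
  assume neq: "deg V a \<noteq> int (card V)"
  have aR: "a \<in> R" and bR: "b \<in> R" using R by auto
  have "deg R a = 2" "deg R b = 2" using R ab by (auto simp: deg_def arcs_between_def)
  then have eq: "deg V a = deg (range x) a + 2" "deg V b = deg (range x) b + 2"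
    by (auto simp: deg_V)
  have ge: "m - 1 \<le> deg (range x) a" "m - 1 \<le> deg (range x) b"
    using deg_ge[OF aR a] deg_ge[OF bR b] eq card_V_eq by auto
  have deg_a: "deg V a = int (card V) - 1"
    using ge eq neq deg_range_x_le[OF aR] card_V_eq by simp
  have ab_path: "\<not> (E (x (k - 1)) a \<and> E b (x (k + 1)))" for k
    using bypass_length[of "[a, b]" "k - 1" 2] aR bR R ab m_ge card_V_eq
    by (auto simp: R_path_def add.commute)
  have ba_path: "\<not> (E (x (k - 1)) b \<and> E a (x (k + 1)))" for k
    using bypass_length[of "[b, a]" "k - 1" 2] aR bR R ab m_ge card_V_eq
    by (auto simp: R_path_def add.commute)
  interpret in_a: periodic_predicate "\<lambda>j. E (x (j - 1)) a" m by (rule periodic_in)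
  interpret in_b: periodic_predicate "\<lambda>j. E (x (j - 1)) b" m by (rule periodic_in)
  have no_dvd_1: "\<not> m dvd 1" "\<not> m dvd - 1" using m_ge by auto
  obtain k where k: "E (x (k - 1)) a" "\<not> E (x k) a"
    using in_a.end_exists[of "ka + 1" ja] not_insertable aR a by auto
  have miss_a: "missed a (l + 1)" if "E (x (l - 1)) a" "\<not> E (x l) a" for l
    using replaceable_end[OF aR that] that deg_a by (auto simp: missed_def)
  have end_a: "m dvd (l - k)" if "E (x (l - 1)) a" "\<not> E (x l) a" for l
    using missed_unique[OF aR ge(1) miss_a[OF that] miss_a[OF k]] by simp
  have not_a_k2: "\<not> E (x (k + 1)) a"
  proof
    assume "E (x (k + 1)) a"
    moreover have "\<not> E (x (ja - 1)) a" using not_insertable aR a by blast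
    ultimately have "m dvd (ja - (k + 1))"
      using in_a.unique_end_misses_one[of k ja] end_a by (simp add: add.commute)
    then have "x ja = x (k + 1)" by (rule x_cong)
    then show False using miss_a[OF k] a by (simp add: missed_def)
  qed
  have not_b_k1: "\<not> E (x k) b"
  proof
    assume "E (x k) b"
    then have "\<not> E a (x (k + 2))" using ba_path[of "k + 1"] by (simp add: add.commute)
    then have "missed a (k + 2)" using not_a_k2 by (simp add: missed_def add.commute)
    then show False using missed_unique[OF aR ge(1) _ miss_a[OF k], of "k + 2"] no_dvd_1 by simp
  qed
  moreover have "\<not> E b (x (k + 1))" using ab_path k by blast
  ultimately have miss_b: "missed b (k + 1)" by (simp add: missed_def)
  then have deg_b: "deg V b < int (card V)" using missed_deg[OF bR] eq card_V_eq by fastforce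
  have end_b: "m dvd (l - k)" if l: "E (x (l - 1)) b" "\<not> E (x l) b" for l
  proof -
    have "missed b (l + 1)"
      using replaceable_end[OF bR l] l deg_b by (auto simp: missed_def)
    then show ?thesis using missed_unique[OF bR ge(2) _ miss_b] by fastforce
  qed
  obtain l where l: "E (x (l - 1)) b" "\<not> E (x l) b"
    using in_b.end_exists[of "kb + 1" jb] not_insertable bR b by auto
  have "E (x (k - 1)) b" using in_b.cong[OF end_b[OF l]] l by simp
  then have nonadj: "\<not> E a (x k)" "\<not> E b (x k)" using k not_insertable aR bR by blast+
  have out_b: "E b (x (k + 2))"
  proof (rule ccontr)
    assume no: "\<not> E b (x (k + 2))"
    have "\<not> missed b (k + 2)" using missed_unique[OF bR ge(2) _ miss_b, of "k + 2"] no_dvd_1 by auto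
    then have "E (x (k + 1)) b" using no by (simp add: missed_def add.commute)
    moreover have "\<not> E (x (jb - 1)) b" using not_insertable bR b by blast
    ultimately have "m dvd (jb - (k + 1))"
      using in_b.unique_end_misses_one[of k jb] end_b by (simp add: add.commute)
    then have "x jb = x (k + 1)" by (rule x_cong)
    then show False using miss_b b by (simp add: missed_def)
  qed
  have m3: "3 \<le> m"
  proof (rule ccontr)
    assume "\<not> 3 \<le> m"
    then have "m = 2" using m_ge by simp
    then show False using out_b nonadj x_period[of k] by simp
  qed
  let ?Q = "map x [k + 2..k + m - 1]"
  note Q = x_interval_path[of "k + 2" "k + m - 1"]
  have inj: "inj_on x {k..k + m - 1}" by (rule inj_on_x) simp
  have xk_Q: "x k \<notin> set ?Q"
    using inj_on_image_mem_iff[OF inj, of k "{k + 2..k + m - 1}"] m3 by auto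
  have deg_xk: "m \<le> deg (set ?Q) (x k)"
  proof -
    have "{k..k + m - 1} = {k + 2..k + m - 1} \<union> {k, k + 1}" using m3 by auto
    then have rng: "range x = set ?Q \<union> {x k, x (k + 1)}" using range_x[of k] by auto
    have "set ?Q \<inter> {x k, x (k + 1)} = {}"
      using inj_on_image_Int[OF inj, of "{k + 2..k + m - 1}" "{k, k + 1}"] m3 by auto
    then have "deg (set ?Q \<union> {x k, x (k + 1)}) (x k)
        = deg (set ?Q) (x k) + deg {x k, x (k + 1)} (x k)"
      by (intro deg_union) auto
    moreover have "deg {x k, x (k + 1)} (x k) \<le> 2"
    proof -
      have "{x k, x (k + 1)} - {x k} \<subseteq> {x (k + 1)}" by auto
      then have "card ({x k, x (k + 1)} - {x k}) \<le> 1"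
        using card_mono[of "{x (k + 1)}"] by fastforce
      moreover have "deg {x k, x (k + 1)} (x k) \<le> 2 * int (card ({x k, x (k + 1)} - {x k}))"
        by (rule deg_le) simp
      ultimately show ?thesis by linarith
    qed
    moreover have "deg R (x k) = 0"
      using R k not_b_k1 nonadj by (intro deg_eq_0) auto
    moreover have "int (card V) \<le> deg V (x k)" using end_pair(2)[OF aR k] deg_a by simp
    ultimately show ?thesis using deg_V[of "x k"] rng card_V_eq by simp
  qed
  have "\<exists>ys c d zs. ?Q = ys @ c # d # zs \<and> E c (x k) \<and> E (x k) d"
  proof (rule ccontr)
    assume "\<not> ?thesis"
    then have "deg (set ?Q) (x k) \<le> int (length ?Q) + of_bool (E (last ?Q) (x k))"
      using Q m3 by (intro path_insertion_bound xk_Q) auto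
    also have "\<dots> \<le> m - 1" using m3 by (simp add: of_bool_def)
    finally show False using deg_xk by simp
  qed
  then obtain ys c d zs where split: "?Q = ys @ c # d # zs" "E c (x k)" "E (x k) d" by blast
  let ?P = "ys @ c # x k # d # zs"
  have elements: "set ?Q = insert c (insert d (set ys \<union> set zs))" unfolding split(1) by auto
  have "is_cycle (?P @ [a, b])"
  proof (rule is_cycle_x_path)
    have "set ?Q \<subseteq> range x" by auto
    then show "set ?P \<subseteq> range x" using elements by auto
    have "distinct ?Q" "successively E ?Q" using Q m3 by auto
    then show "distinct ?P" "successively E ?P"
      using xk_Q elements split unfolding split(1) by (auto simp: successively_append_iff)
    have "last ?P = last ?Q" "hd ?P = hd ?Q" unfolding split(1) by (cases ys; simp)+
    then have "last ?P = x (k - 1)" "hd ?P = x (k + 2)"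
      using Q(4,5) m3 x_period[of "k - 1"] by (auto simp: algebra_simps)
    then show "E (last ?P) (hd [a, b])" "E (last [a, b]) (hd ?P)" using k out_b by auto
  qed (use aR bR R ab in auto)
  moreover have "int (length (?P @ [a, b])) = m + 1"
    using arg_cong[OF split(1), of "\<lambda>q. int (length q)"] m3 by simp
  ultimately show False using length_not_between[of "?P @ [a, b]"] card_V_eq by simp
qed

end

section \<open>The complete bipartite structure\<close>

definition (in arc_relation) balanced_bipartite_up_to_one_arc :: bool where
  "balanced_bipartite_up_to_one_arc \<longleftrightarrow> (\<exists>X Y. V = X \<union> Y \<and> X \<inter> Y = {} \<and> card X = card Y \<and>
     (\<forall>a b. E a b \<longrightarrow> (a, b) \<in> X \<times> Y \<union> Y \<times> X) \<and>
     (\<exists>e. \<forall>a b. (a, b) \<in> X \<times> Y \<union> Y \<times> X \<longrightarrow> (a, b) \<noteq> e \<longrightarrow> E a b))"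

context longest_cycle begin

definition alternates :: "'a \<Rightarrow> 'a \<Rightarrow> int \<Rightarrow> bool" where
  "alternates a b k \<longleftrightarrow> R = {a, b} \<and> a \<noteq> b \<and> E a b \<and> E b a \<and> even m \<and>
     (\<forall>j. (E a (x j) \<longleftrightarrow> odd (j - k)) \<and> (E (x j) a \<longleftrightarrow> odd (j - k)) \<and>
          (E b (x j) \<longleftrightarrow> even (j - k)) \<and> (E (x j) b \<longleftrightarrow> even (j - k)))"

lemma alternates_swap: "alternates a b k \<Longrightarrow> alternates b a (k + 1)"
  by (auto simp: alternates_def)

text \<open>Let \<open>a\<close> take the place of \<open>x l\<close>. An arc from \<open>x j\<close> to \<open>x l\<close> would give the bypass
  \<open>x j \<rightarrow> x l \<rightarrow> b \<rightarrow> x (j + 2)\<close> of the new cycle, which skips a single vertex.\<close>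

lemma alternates_same_parity_nonadjacent:
  assumes alt: "alternates a b k" and even: "even (j - k)" "even (l - k)"
  shows "\<not> E (x j) (x l)"
proof
  assume E: "E (x j) (x l)"
  have aR: "a \<in> R" using alt by (auto simp: alternates_def)
  have cyc: "cyclic_sequence m (replace l a)"
    using alt even by (intro cyclic_sequence_replace aR) (auto simp: alternates_def)
  interpret y: longest_cycle V E m "replace l a"
    using cyc m_ge m_le longest by unfold_locales
  have yR: "y.R = {x l, b}"
    using outside_replace[OF aR, of l] alt by (auto simp: y.R_def alternates_def)
  have "b \<noteq> x l" using alt x_not_R by (auto simp: alternates_def)
  moreover have "E (x l) b" using alt even by (auto simp: alternates_def)
  ultimately have path: "y.R_path [x l, b]" by (auto simp: y.R_path_def yR)
  have "x j \<noteq> x l" using E by auto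
  then have "replace l a j = x j" by (simp add: replace_def x_eq_iff)
  moreover have "E b (replace l a (j + 2))"
    using alt even by (auto simp: alternates_def replace_def)
  ultimately show False
    using y.bypass_length[OF path, of j 2] E m_ge card_V_eq by auto
qed

lemma even_block_eq_odd_block:
  assumes "even m"
  shows "card (x ` {j. even (j - k)}) = card (x ` {j. odd (j - k)})"
    "2 * int (card (x ` {j. even (j - k)})) = m"
    "x ` {j. even (j - k)} \<inter> x ` {j. odd (j - k)} = {}"
proof -
  let ?W = "{k..k + m - 1}"
  have window: "x ` {j. Q j} = x ` {j \<in> ?W. Q j}"
    if Q: "\<And>i j. even (i - j) \<Longrightarrow> Q i = Q j" for Q
  proof
    show "x ` {j. Q j} \<subseteq> x ` {j \<in> ?W. Q j}"
    proof
      fix v assume "v \<in> x ` {j. Q j}"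
      then obtain j where j: "Q j" "v = x j" by auto
      obtain j' where j': "k \<le> j'" "j' < k + m" "x j' = x j" using shift_window by blast
      then have "even (j' - j)" using assms by (meson dvd_trans x_eq_iff)
      then have "Q j'" using Q j by blast
      then show "v \<in> x ` {j \<in> ?W. Q j}" using j j' by (intro image_eqI[of _ _ j']) auto
    qed
  qed auto
  have inj: "inj_on x ?W" by (rule inj_on_x) simp
  let ?Ev = "{j \<in> ?W. even (j - k)}" and ?Od = "{j \<in> ?W. odd (j - k)}"
  have ev: "x ` {j. even (j - k)} = x ` ?Ev" by (rule window) presburger
  have od: "x ` {j. odd (j - k)} = x ` ?Od" by (rule window) presburger
  have "bij_betw (\<lambda>j. j + 1) ?Ev ?Od"
    using assms
    by (intro bij_betw_byWitness[where f' = "\<lambda>j. j - 1"]) (auto, presburger+)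
  then have "card ?Ev = card ?Od" by (rule bij_betw_same_card)
  moreover have cards: "card (x ` ?Ev) = card ?Ev" "card (x ` ?Od) = card ?Od"
    using inj by (auto intro!: card_image elim: inj_on_subset)
  ultimately show eq: "card (x ` {j. even (j - k)}) = card (x ` {j. odd (j - k)})"
    unfolding ev od by simp
  have "x ` ?Ev \<inter> x ` ?Od = x ` (?Ev \<inter> ?Od)"
    by (rule inj_on_image_Int[OF inj, symmetric]) auto
  then show disj: "x ` {j. even (j - k)} \<inter> x ` {j. odd (j - k)} = {}"
    unfolding ev od by auto
  have "?Ev \<union> ?Od = ?W" "?Ev \<inter> ?Od = {}" by auto
  moreover have "finite ?Ev" "finite ?Od" by (auto intro: finite_subset[of _ ?W])
  ultimately have "card ?W = card ?Ev + card ?Od"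
    using card_Un_disjoint[of ?Ev ?Od] by metis
  then show "2 * int (card (x ` {j. even (j - k)})) = m"
    using \<open>card ?Ev = card ?Od\<close> cards m_ge unfolding ev by simp
qed

text \<open>Both parity classes, extended by \<open>a\<close> and by \<open>b\<close>, are independent. All vertices of the class
  \<open>X\<close> of \<open>a\<close> are dominated by \<open>b\<close>, so any two of them have degree sum at least \<open>2 * card V - 1\<close>, while
  a vertex of \<open>X\<close> has degree at most \<open>2 * card Y = card V\<close>. Hence the vertices of \<open>X\<close> lack at most one
  arc altogether, and every arc between \<open>X\<close> and \<open>Y\<close> has an end in \<open>X\<close>.\<close>

lemma alternates_imp_bipartite:
  assumes alt: "alternates a b k"
  shows balanced_bipartite_up_to_one_arc
proof -
  have R: "R = {a, b}" "a \<noteq> b" and ab: "E a b" "E b a" and m_even: "even m"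
    using alt by (auto simp: alternates_def)
  have a_x: "E a (x j) \<longleftrightarrow> odd (j - k)" "E (x j) a \<longleftrightarrow> odd (j - k)"
    and b_x: "E b (x j) \<longleftrightarrow> even (j - k)" "E (x j) b \<longleftrightarrow> even (j - k)" for j
    using alt by (auto simp: alternates_def)
  have same_even: "\<not> E (x j) (x l)" if "even (j - k)" "even (l - k)" for j l
    using alternates_same_parity_nonadjacent[OF alt] that by blast
  have same_odd: "\<not> E (x j) (x l)" if "odd (j - k)" "odd (l - k)" for j l
    using alternates_same_parity_nonadjacent[OF alternates_swap[OF alt], of j l] that by auto
  define X where "X = insert a (x ` {j. even (j - k)})"
  define Y where "Y = insert b (x ` {j. odd (j - k)})"
  note blocks = even_block_eq_odd_block[OF m_even, of k]
  have a_range: "a \<notin> range x" and b_range: "b \<notin> range x" using R x_not_R by auto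
  have fin: "finite (x ` J)" for J by (rule finite_subset[OF _ finite_range_x]) auto
  have card_X: "2 * int (card X) = int (card V)" and card_XY: "card X = card Y"
  proof -
    have "a \<notin> x ` J" "b \<notin> x ` J" for J using a_range b_range by auto
    then have "card X = Suc (card (x ` {j. even (j - k)}))"
      "card Y = Suc (card (x ` {j. odd (j - k)}))"
      using fin by (auto simp: X_def Y_def simp del: even_diff)
    then show "2 * int (card X) = int (card V)" "card X = card Y"
      using blocks(1,2) card_V_eq by auto
  qed
  have "V = {a, b} \<union> range x" using V_split(1) unfolding R(1) .
  also have "range x = x ` {j. even (j - k)} \<union> x ` {j. odd (j - k)}" by blast
  finally have V_XY: "V = X \<union> Y" unfolding X_def Y_def by blast
  have XY: "X \<inter> Y = {}"
    using blocks(3) a_range b_range R(2) unfolding X_def Y_def by blast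
  have indep_X: "\<not> E v v'" if "v \<in> X" "v' \<in> X" for v v'
    using that same_even a_x E_irrefl unfolding X_def by blast
  have indep_Y: "\<not> E v v'" if "v \<in> Y" "v' \<in> Y" for v v'
    using that same_odd b_x E_irrefl unfolding Y_def by blast
  have arcs: "\<forall>v y. E v y \<longrightarrow> (v, y) \<in> X \<times> Y \<union> Y \<times> X"
  proof (intro allI impI)
    fix v y assume "E v y"
    moreover from this have "v \<in> X \<union> Y" "y \<in> X \<union> Y" using E_V V_XY by auto
    ultimately show "(v, y) \<in> X \<times> Y \<union> Y \<times> X" using indep_X indep_Y by auto
  qed
  have b_X: "E b v" if "v \<in> X" for v using that ab b_x unfolding X_def by blast
  have finXY: "finite X" "finite Y" using fin by (auto simp: X_def Y_def)
  have xk: "x k \<in> X" "a \<in> X" "x k \<noteq> a" using a_range by (auto simp: X_def)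
  have pair: "2 * int (card V) - 1 \<le> deg V v + deg V v' \<and> int (card V) - 1 \<le> deg V v"
    if "v \<in> X" "v' \<in> X" "v \<noteq> v'" for v v'
    using dominated_pair[OF that(3) indep_X[OF that(1,2)] indep_X[OF that(2,1)]
        b_X[OF that(1)] b_X[OF that(2)]] by simp
  define defect where
    "defect v = int (card {y \<in> Y. \<not> E v y}) + int (card {y \<in> Y. \<not> E y v})" for v
  have deg_defect: "deg V v + defect v = int (card V)" if v: "v \<in> X" for v
  proof -
    have "deg V v = deg X v + deg Y v"
      using deg_union[of X Y v] finXY XY V_XY by simp
    moreover have "deg X v = 0" using indep_X v by (intro deg_eq_0) auto
    moreover have "int (card {y \<in> Y. Q y}) + int (card {y \<in> Y. \<not> Q y}) = int (card Y)" for Q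
    proof -
      have "Y = {y \<in> Y. Q y} \<union> {y \<in> Y. \<not> Q y}" by auto
      then have "card Y = card {y \<in> Y. Q y} + card {y \<in> Y. \<not> Q y}"
        using card_Un_disjoint[of "{y \<in> Y. Q y}" "{y \<in> Y. \<not> Q y}"] finXY by auto
      then show ?thesis by simp
    qed
    note this[of "E v"] this[of "\<lambda>y. E y v"]
    ultimately show ?thesis
      using deg_eq_card[OF finXY(2), of v] card_X card_XY by (simp add: defect_def)
  qed
  have defect_pair: "defect v + defect v' \<le> 1" if "v \<in> X" "v' \<in> X" "v \<noteq> v'" for v v'
    using pair[OF that] deg_defect[OF that(1)] deg_defect[OF that(2)] by linarith
  have defect_le: "defect v \<le> 1" if "v \<in> X" for v
  proof -
    obtain v' where "v' \<in> X" "v' \<noteq> v" using xk by metis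
    then show ?thesis using pair[of v v'] deg_defect[OF that] that by force
  qed
  have missing_unique: "e = e'"
    if e: "e \<in> X \<times> Y \<union> Y \<times> X" "\<not> E (fst e) (snd e)"
      and e': "e' \<in> X \<times> Y \<union> Y \<times> X" "\<not> E (fst e') (snd e')" for e e'
  proof (rule ccontr)
    assume "e \<noteq> e'"
    \<comment> \<open>the arcs missing at \<open>v\<close> correspond to the elements of the disjoint sum of \<open>Out v\<close> and \<open>In v\<close>\<close>
    define Out where "Out v = {y \<in> Y. \<not> E v y}" for v
    define In where "In v = {y \<in> Y. \<not> E y v}" for v
    have finOI: "finite (Out v)" "finite (In v)" for v using finXY by (auto simp: Out_def In_def)
    have defect_card: "defect v = int (card (Out v <+> In v))" for v
      using finOI by (simp add: defect_def Out_def In_def card_Plus)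
    have in_defect: "\<exists>v\<in>X. \<exists>t. t \<in> Out v <+> In v \<and>
        e = (case t of Inl y \<Rightarrow> (v, y) | Inr y \<Rightarrow> (y, v))"
      if "e \<in> X \<times> Y \<union> Y \<times> X" "\<not> E (fst e) (snd e)" for e
      using that(1)
    proof
      assume "e \<in> X \<times> Y"
      then show ?thesis using that(2)
        by (intro bexI[of _ "fst e"] exI[of _ "Inl (snd e)"]) (auto simp: Out_def)
    next
      assume "e \<in> Y \<times> X"
      then show ?thesis using that(2)
        by (intro bexI[of _ "snd e"] exI[of _ "Inr (fst e)"]) (auto simp: In_def)
    qed
    obtain v t where v: "v \<in> X" "t \<in> Out v <+> In v"
      "e = (case t of Inl y \<Rightarrow> (v, y) | Inr y \<Rightarrow> (y, v))" using in_defect[OF e] by blast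
    obtain v' t' where v': "v' \<in> X" "t' \<in> Out v' <+> In v'"
      "e' = (case t' of Inl y \<Rightarrow> (v', y) | Inr y \<Rightarrow> (y, v'))" using in_defect[OF e'] by blast
    have fin_Plus: "finite (Out v <+> In v)" for v using finOI by (simp add: finite_Plus)
    have pos: "1 \<le> defect v" if "t \<in> Out v <+> In v" for v t
    proof -
      have "card (Out v <+> In v) \<noteq> 0" using that fin_Plus by auto
      then show ?thesis unfolding defect_card by linarith
    qed
    show False
    proof (cases "v = v'")
      case True
      then have "t \<noteq> t'" using v(3) v'(3) \<open>e \<noteq> e'\<close> by auto
      moreover have "card {t, t'} \<le> card (Out v <+> In v)"
        using v(2) v'(2) True by (intro card_mono fin_Plus) auto
      ultimately show False using defect_le[OF v(1)] unfolding defect_card by simp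
    next
      case False
      then show False using defect_pair[OF v(1) v'(1)] pos[OF v(2)] pos[OF v'(2)] by simp
    qed
  qed
  have "\<exists>e. \<forall>v y. (v, y) \<in> X \<times> Y \<union> Y \<times> X \<longrightarrow> (v, y) \<noteq> e \<longrightarrow> E v y"
  proof (cases "\<exists>e\<in>X \<times> Y \<union> Y \<times> X. \<not> E (fst e) (snd e)")
    case True
    then obtain e where e: "e \<in> X \<times> Y \<union> Y \<times> X" "\<not> E (fst e) (snd e)" by blast
    have "E v y" if "(v, y) \<in> X \<times> Y \<union> Y \<times> X" "(v, y) \<noteq> e" for v y
      using missing_unique[OF e that(1)] that(2) by auto
    then show ?thesis by (intro exI[of _ e] allI impI)
  next
    case False
    then have "E v y" if "(v, y) \<in> X \<times> Y \<union> Y \<times> X" for v y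
      using that by (metis fst_conv snd_conv)
    then show ?thesis by blast
  qed
  then show ?thesis
    unfolding balanced_bipartite_up_to_one_arc_def using V_XY XY card_XY arcs
    by (intro exI[of _ X] exI[of _ Y] conjI)
qed

end

context heaviest_outside begin

text \<open>Both vertices off the cycle have full degree, so neither misses a slot: at each slot exactly one of
  the two possible arcs is present. The detours through \<open>a\<close> and \<open>b\<close> shift the in-neighbours of one to
  those of the other, hence by two steps those of \<open>a\<close> to themselves.\<close>

lemma bipartite: balanced_bipartite_up_to_one_arc
proof -
  obtain a b ka ja kb jb where R: "a \<noteq> b" "R = {a, b}" and ab: "E a b"
    and a: "E (x ka) a" "E a (x ja)" and b: "E (x kb) b" "E b (x jb)"
    using two_vertices_outside by blast
  have ba: "E b a" using both_directions[OF R(2,1) ab a] .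
  have aR: "a \<in> R" and bR: "b \<in> R" using R by auto
  have "deg R a = 2" "deg R b = 2" using R ab ba by (auto simp: deg_def arcs_between_def)
  moreover have "deg V a = int (card V)"
    using outside_full_degree[OF R(2,1) ab ba a b] .
  moreover have "deg V b = int (card V)"
    using outside_full_degree[of b a, OF _ _ ba ab b a] R by auto
  ultimately have full: "m \<le> deg (range x) a" "m \<le> deg (range x) b"
    using deg_V card_V_eq by auto
  have out_a: "E a (x j) \<longleftrightarrow> \<not> E (x (j - 1)) a" for j
    using not_insertable[OF aR, of j] missed_deg[OF aR, of j] full by (auto simp: missed_def)
  have out_b: "E b (x j) \<longleftrightarrow> \<not> E (x (j - 1)) b" for j
    using not_insertable[OF bR, of j] missed_deg[OF bR, of j] full by (auto simp: missed_def)
  have a_to_b: "E (x (j + 1)) b" if "E (x j) a" for j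
    using bypass_length[of "[a, b]" j 2] that aR bR R ab m_ge card_V_eq out_b[of "j + 2"]
    by (auto simp: R_path_def algebra_simps)
  have b_to_a: "E (x (j + 1)) a" if "E (x j) b" for j
    using bypass_length[of "[b, a]" j 2] that aR bR R ba m_ge card_V_eq out_a[of "j + 2"]
    by (auto simp: R_path_def algebra_simps)
  have every_second: "E (x (j + 2 * t)) a" if "E (x j) a" for j t
  proof -
    interpret periodic_predicate "\<lambda>t. E (x (j + 2 * t)) a" m
    proof
      fix s t assume "m dvd (s - t)"
      then have "m dvd (2 * (s - t))" by (rule dvd_mult)
      moreover have "2 * (s - t) = (j + 2 * s) - (j + 2 * t)" by simp
      ultimately have "x (j + 2 * s) = x (j + 2 * t)" using x_cong by metis
      then show "E (x (j + 2 * s)) a = E (x (j + 2 * t)) a" by simp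
    qed (use m_ge in simp)
    have "E (x (j + 2 * (s + 1))) a" if "E (x (j + 2 * s)) a" for s
      using b_to_a[OF a_to_b[OF that]] by (simp add: algebra_simps)
    then show ?thesis using end_exists[of 0 t] that by auto
  qed
  have a_parity: "E (x j) a \<longleftrightarrow> even (j - ka)" for j
  proof
    assume "even (j - ka)"
    then obtain t where "j = ka + 2 * t" by (metis dvdE diff_add_cancel add.commute)
    then show "E (x j) a" using every_second[OF a(1)] by simp
  next
    assume j: "E (x j) a"
    show "even (j - ka)"
    proof (rule ccontr)
      assume odd: "odd (j - ka)"
      have "E (x i) a" for i
      proof (cases "even (i - ka)")
        case True
        then obtain t where "i = ka + 2 * t" by (metis dvdE diff_add_cancel add.commute)
        then show ?thesis using every_second[OF a(1)] by simp
      next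
        case False
        then have "even (i - j)" using odd by presburger
        then obtain t where "i = j + 2 * t" by (metis dvdE diff_add_cancel add.commute)
        then show ?thesis using every_second[OF j] by simp
      qed
      then show False using out_a[of ja] a by blast
    qed
  qed
  have b_parity: "E (x j) b \<longleftrightarrow> odd (j - ka)" for j
  proof
    assume "E (x j) b"
    then show "odd (j - ka)" using b_to_a[of j] a_parity[of "j + 1"] by auto
  next
    assume "odd (j - ka)"
    then have "E (x (j - 1)) a" using a_parity[of "j - 1"] by auto
    then show "E (x j) b" using a_to_b[of "j - 1"] by simp
  qed
  have "even m" using a_parity[of "ka + m"] a(1) x_period[of ka] by simp
  then have "alternates a b (ka + 1)"
    using R ab ba a_parity b_parity out_a out_b by (auto simp: alternates_def)
  then show ?thesis by (rule alternates_imp_bipartite)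
qed

end

context bjgl_digraph begin

lemma cycle_length_le: "is_cycle xs \<Longrightarrow> set xs \<subseteq> V \<and> 2 \<le> length xs \<and> length xs \<le> card V"
proof -
  assume c: "is_cycle xs"
  obtain y ys where xs: "xs = y # ys" using c by (cases xs) (auto simp: is_cycle_def)
  have ys: "ys \<noteq> []" using c xs by (auto simp: is_cycle_def)
  have "v \<in> V" if v: "v \<in> set xs" for v
  proof -
    obtain as bs where split: "xs = as @ v # bs" using v by (meson split_list)
    show ?thesis
    proof (cases bs)
      case Nil
      then show ?thesis using c E_V split by (auto simp: is_cycle_def)
    next
      case (Cons z zs)
      then show ?thesis using c E_V split by (auto simp: is_cycle_def successively_append_iff)
    qed
  qed
  then have sub: "set xs \<subseteq> V" by blast
  then have "card (set xs) \<le> card V" by (intro card_mono) auto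
  then show ?thesis using sub c xs ys by (cases ys) (auto simp: is_cycle_def distinct_card)
qed

text \<open>A shortest cycle is not Hamiltonian, since a vertex has a second out-neighbour and the
  corresponding chord would shorten the cycle.\<close>

lemma nonhamiltonian_cycle_exists:
  assumes "V \<noteq> {}"
  shows "\<exists>xs. is_cycle xs \<and> length xs < card V"
proof -
  have cycle_exists: "\<exists>xs. is_cycle xs"
  proof -
    obtain v where v: "v \<in> V" using assms by blast
    obtain y where y: "E v y" using another_out[OF v] by blast
    then have "E\<^sup>*\<^sup>* y v" using strong E_V by blast
    then obtain p where "p \<noteq> []" "hd p = y" "last p = v" "distinct p" "successively E p"
      using rtranclp_distinct_path by metis
    then show ?thesis using y by (auto simp: is_cycle_def)
  qed
  then obtain xs where xs: "is_cycle xs" "\<And>ys. is_cycle ys \<Longrightarrow> length xs \<le> length ys"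
    using ex_has_least_nat[of is_cycle _ length] by blast
  have "length xs \<noteq> card V"
  proof
    assume len: "length xs = card V"
    have bounds: "set xs \<subseteq> V" "2 \<le> length xs" using cycle_length_le[OF xs(1)] by auto
    then have V: "set xs = V"
      using len xs(1) by (intro card_subset_eq) (auto simp: is_cycle_def distinct_card)
    obtain v w ps where xs_eq: "xs = v # w # ps"
      using bounds(2) by (cases xs rule: remdups_adj.cases) auto
    obtain y where y: "E v y" "y \<noteq> w" using another_out[of v w] V xs_eq by auto
    then have "y \<in> set ps" using E_V[OF y(1)] V xs_eq by auto
    then obtain as bs where "ps = as @ y # bs" by (meson split_list)
    then have "is_cycle (v # y # bs)"
      using xs(1) xs_eq y by (auto simp: is_cycle_def successively_append_iff successively_Cons)
    then show False using xs(2)[of "v # y # bs"] xs_eq \<open>ps = as @ y # bs\<close> by simp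
  qed
  then show ?thesis using xs cycle_length_le by (meson le_neq_implies_less)
qed

theorem bipartite_if_no_prehamiltonian:
  assumes "V \<noteq> {}"
  shows balanced_bipartite_up_to_one_arc
proof -
  obtain xs where xs: "is_cycle xs" "length xs < card V"
    and max: "\<And>ys. is_cycle ys \<Longrightarrow> length ys < card V \<Longrightarrow> length ys \<le> length xs"
    using nonhamiltonian_cycle_exists[OF assms]
      ex_has_greatest_nat[of "\<lambda>ys. is_cycle ys \<and> length ys < card V" _ length "card V"]
    by (metis less_imp_le)
  define m where "m = int (length xs)"
  have len: "length xs + 2 \<le> card V" using xs no_prehamiltonian[OF xs(1)] by linarith
  define weight where "weight y = nat (\<Sum>z\<in>V - range y. deg V z)" for y :: "int \<Rightarrow> 'a"
  have deg_nonneg: "0 \<le> deg V z" for z by (simp add: deg_def sum_nonneg arcs_between_le)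
  have "weight y \<le> nat (\<Sum>z\<in>V. deg V z)" for y
    unfolding weight_def using deg_nonneg by (intro nat_mono sum_mono2) auto
  then obtain x where x: "cyclic_sequence m x"
    and heavy: "\<And>y. cyclic_sequence m y \<Longrightarrow> weight y \<le> weight x"
    using ex_has_greatest_nat[of "cyclic_sequence m" _ weight "Suc (nat (\<Sum>z\<in>V. deg V z))"]
      cyclic_sequence_of_cycle[OF xs(1)] unfolding m_def by (metis le_imp_less_Suc)
  interpret longest_cycle V E m x
  proof
    show "length ys = card V" if "is_cycle ys" "m < int (length ys)" for ys
      using max[of ys] that cycle_length_le[of ys] by (fastforce simp: m_def)
    show "2 \<le> m" using cycle_length_le[OF xs(1)] by (simp add: m_def)
    show "m + 2 \<le> int (card V)" using len by (simp add: m_def)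
  qed (rule x)
  interpret heaviest_outside V E m x
  proof
    fix y assume "cyclic_sequence m y"
    then have "weight y \<le> weight x" by (rule heavy)
    then show "(\<Sum>z\<in>V - range y. deg V z) \<le> (\<Sum>z\<in>R. deg V z)"
      unfolding weight_def R_def using deg_nonneg by (simp add: nat_le_eq_zle sum_nonneg)
  qed
  show ?thesis by (rule bipartite)
qed

end

section \<open>Transfer to digraphs with arcs\<close>

context digraph begin

lemma dominates_in_verts: "a \<rightarrow>\<^bsub>G\<^esub> b \<Longrightarrow> a \<in> verts G \<and> b \<in> verts G"
  by (auto intro: adj_in_verts)

lemma arc_relation: "arc_relation (verts G) (dominates G)"
  using dominates_in_verts adj_not_same by unfold_locales auto

lemma out_degree_eq: "out_degree G v = card {y \<in> verts G. v \<rightarrow>\<^bsub>G\<^esub> y}"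
proof -
  have "bij_betw (head G) (out_arcs G v) {y \<in> verts G. v \<rightarrow>\<^bsub>G\<^esub> y}"
    by (auto simp: bij_betw_def inj_on_def arcs_ends_conv arc_to_ends_def intro!: no_multi_arcs)
  then show ?thesis unfolding out_degree_def by (rule bij_betw_same_card)
qed

lemma in_degree_eq: "in_degree G v = card {y \<in> verts G. y \<rightarrow>\<^bsub>G\<^esub> v}"
proof -
  have "bij_betw (tail G) (in_arcs G v) {y \<in> verts G. y \<rightarrow>\<^bsub>G\<^esub> v}"
    by (auto simp: bij_betw_def inj_on_def arcs_ends_conv arc_to_ends_def intro!: no_multi_arcs)
  then show ?thesis unfolding in_degree_def by (rule bij_betw_same_card)
qed

lemma degree_eq: "int (degree G v) = arc_relation.deg (dominates G) (verts G) v"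
proof -
  interpret arc_relation "verts G" "dominates G" by (rule arc_relation)
  show ?thesis by (simp add: degree_def out_degree_eq in_degree_eq deg_eq_card)
qed

lemma awalk_of_path:
  assumes "successively (dominates G) (v # vs)" "v \<in> verts G"
  shows "\<exists>p. awalk v p (last (v # vs)) \<and> awalk_verts v p = v # vs"
  using assms
proof (induction vs arbitrary: v)
  case Nil
  then show ?case by (intro exI[of _ "[]"]) (simp add: awalk_Nil_iff)
next
  case (Cons w vs)
  then have w: "v \<rightarrow>\<^bsub>G\<^esub> w" "successively (dominates G) (w # vs)" by auto
  then obtain p where "awalk w p (last (w # vs))" "awalk_verts w p = w # vs"
    using Cons.IH dominates_in_verts by blast
  moreover obtain e where "e \<in> arcs G" "tail G e = v" "head G e = w" using w by auto
  ultimately show ?case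
    using Cons.prems by (intro exI[of _ "e # p"]) (auto simp: awalk_Cons_iff)
qed

lemma cycle_of_vertex_list:
  assumes "arc_relation.is_cycle (dominates G) vs"
  shows "\<exists>c. cycle c \<and> length c = length vs"
proof -
  interpret arc_relation "verts G" "dominates G" by (rule arc_relation)
  obtain v ws where vs: "vs = v # ws" using assms by (cases vs) (auto simp: is_cycle_def)
  have close: "last vs \<rightarrow>\<^bsub>G\<^esub> v" using assms vs by (auto simp: is_cycle_def)
  then have v: "v \<in> verts G" using dominates_in_verts by blast
  then obtain p where p: "awalk v p (last vs)" "awalk_verts v p = vs"
    using awalk_of_path[of v ws] assms vs by (auto simp: is_cycle_def)
  obtain e where e: "e \<in> arcs G" "tail G e = last vs" "head G e = v" using close by auto
  then have "awalk (last vs) [e] v" using v by (simp add: awalk_Cons_iff awalk_Nil_iff)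
  then have walk: "awalk v (p @ [e]) v" using p by auto
  then have "awalk_verts v (p @ [e]) = vs @ [v]"
    using p e by (simp add: awalk_verts_append)
  moreover have "distinct (tl (vs @ [v]))" using assms vs by (auto simp: is_cycle_def)
  ultimately have "cycle (p @ [e])" unfolding cycle_def using walk by auto
  moreover have "length (p @ [e]) = length vs"
    using arg_cong[OF p(2), of length] by (simp add: length_awalk_verts)
  ultimately show ?thesis by blast
qed

end

definition standard_bipartite :: "nat \<Rightarrow> (nat, nat \<times> nat) pre_digraph" where
  "standard_bipartite k = \<lparr>verts = {0..<2 * k},
     arcs = {0..<k} \<times> {k..<2 * k} \<union> {k..<2 * k} \<times> {0..<k}, tail = fst, head = snd\<rparr>"

lemma complete_bipartite_standard: "complete_bipartite_digraph k k (standard_bipartite k)"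
proof -
  let ?K = "standard_bipartite k"
  have ends: "arcs_ends ?K = {0..<k} \<times> {k..<2 * k} \<union> {k..<2 * k} \<times> {0..<k}"
    by (simp add: arcs_ends_def arc_to_ends_def standard_bipartite_def image_def)
  have "digraph ?K"
    by unfold_locales (auto simp: standard_bipartite_def arc_to_ends_def)
  moreover have "symmetric ?K" unfolding symmetric_def ends by (auto simp: sym_def)
  ultimately have "graph ?K" by (rule digraph.graphI)
  moreover have "verts ?K = {0..<k} \<union> {k..<2 * k}" by (auto simp: standard_bipartite_def)
  ultimately show ?thesis
    unfolding complete_bipartite_digraph_def using ends
    by (intro conjI exI[of _ "{0..<k}"] exI[of _ "{k..<2 * k}"]) auto
qed

text \<open>The pair \<open>e\<close> is only a possible exception: if all pairs between \<open>X\<close> and \<open>Y\<close> are arcs, the digraph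
  is complete bipartite, and otherwise \<open>e\<close> is the missing arc.\<close>

lemma (in digraph) iso_standard_bipartite:
  assumes V: "verts G = X \<union> Y" "X \<inter> Y = {}" and card: "card X = k" "card Y = k"
    and bip: "\<And>a b. a \<rightarrow>\<^bsub>G\<^esub> b \<Longrightarrow> (a, b) \<in> X \<times> Y \<union> Y \<times> X"
    and almost: "\<And>a b. (a, b) \<in> X \<times> Y \<union> Y \<times> X \<Longrightarrow> (a, b) \<noteq> e \<Longrightarrow> a \<rightarrow>\<^bsub>G\<^esub> b"
  shows "digraph_iso G (standard_bipartite k) \<or>
    (\<exists>e\<in>arcs (standard_bipartite k). digraph_iso G (pre_digraph.del_arc (standard_bipartite k) e))"
proof -
  have fin: "finite X" "finite Y" using V by (metis finite_Un finite_verts)+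
  obtain f where f: "bij_betw f X {0..<k}"
    using fin card ex_bij_betw_finite_nat by blast
  obtain g where g: "bij_betw g Y {k..<2 * k}"
    using fin card by (metis card_atLeastLessThan add_diff_cancel_left' mult_2
        finite_atLeastLessThan finite_same_card_bij)
  define \<phi> where "\<phi> a = (if a \<in> X then f a else g a)" for a
  have bij_X: "bij_betw \<phi> X {0..<k}"
    using f by (subst bij_betw_cong[of X \<phi> f]) (auto simp: \<phi>_def)
  have bij_Y: "bij_betw \<phi> Y {k..<2 * k}"
    using g V(2) by (subst bij_betw_cong[of Y \<phi> g]) (auto simp: \<phi>_def)
  have bij: "bij_betw \<phi> (verts G) {0..<2 * k}"
  proof -
    have "{0..<k} \<union> {k..<2 * k} = {0..<2 * k}" "{0..<k} \<inter> {k..<2 * k} = {}" by auto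
    then show ?thesis using bij_betw_combine[OF bij_X bij_Y] V by simp
  qed
  define \<psi> where "\<psi> = map_prod \<phi> \<phi>"
  let ?full = "X \<times> Y \<union> Y \<times> X"
  define h :: "('a, 'b, nat, nat \<times> nat) digraph_isomorphism" where
    "h = \<lparr>iso_verts = \<phi>, iso_arcs = \<psi> \<circ> arc_to_ends G, iso_head = snd, iso_tail = fst\<rparr>"
  have inj_\<psi>: "inj_on \<psi> (verts G \<times> verts G)"
    using bij unfolding \<psi>_def bij_betw_def by (intro map_prod_inj_on) auto
  have inj_arcs: "inj_on (\<psi> \<circ> arc_to_ends G) (arcs G)"
    using inj_on_arc_to_ends
    by (intro comp_inj_on inj_on_subset[OF inj_\<psi>]) (auto simp: arc_to_ends_def)
  have iso: "digraph_isomorphism h"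
    unfolding digraph_isomorphism_def
  proof (intro conjI)
    show "wf_digraph G" by (rule wf_digraph)
  qed (use bij inj_arcs in \<open>auto simp: h_def bij_betw_def \<psi>_def arc_to_ends_def\<close>)
  have app: "app_iso h G = \<lparr>verts = {0..<2 * k}, arcs = \<psi> ` arcs_ends G, tail = fst, head = snd\<rparr>"
    using bij by (simp add: app_iso_def h_def bij_betw_def image_comp arcs_ends_def)
  have full: "\<psi> ` ?full = arcs (standard_bipartite k)"
    using bij_X bij_Y unfolding \<psi>_def bij_betw_def
    by (simp add: image_Un map_prod_surj_on standard_bipartite_def)
  have sub: "arcs_ends G \<subseteq> ?full" "?full - {e} \<subseteq> arcs_ends G" using bip almost by auto
  show ?thesis
  proof (cases "arcs_ends G = ?full")
    case True
    then have "app_iso h G = standard_bipartite k"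
      using app full by (simp add: standard_bipartite_def)
    then show ?thesis using iso unfolding digraph_iso_def by metis
  next
    case False
    then have e: "e \<in> ?full" and ends: "arcs_ends G = ?full - {e}" using sub by auto
    have "inj_on \<psi> ?full" by (rule inj_on_subset[OF inj_\<psi>]) (auto simp: V)
    then have "\<psi> ` arcs_ends G = arcs (standard_bipartite k) - {\<psi> e}"
      unfolding ends full[symmetric] using e by (simp add: inj_on_image_set_diff[of \<psi> ?full ?full "{e}"])
    then have "app_iso h G = pre_digraph.del_arc (standard_bipartite k) (\<psi> e)"
      using app by (simp add: standard_bipartite_def pre_digraph.del_arc_def)
    moreover have "\<psi> e \<in> arcs (standard_bipartite k)" using e full by blast
    ultimately show ?thesis using iso unfolding digraph_iso_def by metis
  qed
qed

theorem theorem1: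
  fixes D :: "('a, 'b) pre_digraph" and n :: nat
  assumes "digraph D"
    and "card (verts D) = n"
    and "strongly_connected D"
    and "\<And>v. v \<in> verts D \<Longrightarrow> out_degree D v \<ge> 2 \<and> in_degree D v \<ge> 2"
    and "\<And>x y. nonadjacent D x y \<Longrightarrow> common_in_neighbour D x y \<Longrightarrow>
           int (degree D x) + int (degree D y) \<ge> 2 * int n - 1 \<and>
           int (min (degree D x) (degree D y)) \<ge> int n - 1"
  shows "(\<exists>c. pre_digraph.cycle D c \<and> int (length c) = int n - 1) \<or>
         (even n \<and>
          (\<exists>K :: (nat, nat \<times> nat) pre_digraph.
             complete_bipartite_digraph (n div 2) (n div 2) K \<and>
             (digraph_iso D K \<or>
              (\<exists>e \<in> arcs K. digraph_iso D (pre_digraph.del_arc K e)))))"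
proof (cases "\<exists>c. pre_digraph.cycle D c \<and> int (length c) = int n - 1")
  case False
  interpret digraph D by (rule assms(1))
  interpret arc_relation "verts D" "dominates D" by (rule arc_relation)
  interpret bjgl_digraph "verts D" "dominates D"
  proof
    fix a b assume "a \<in> verts D" "b \<in> verts D"
    then have "(a, b) \<in> (arcs_ends D)\<^sup>*"
      using assms(3) by (auto intro: reachable_rtranclI)
    then show "(dominates D)\<^sup>*\<^sup>* a b" by (simp add: rtranclp_rtrancl_eq)
  next
    fix v assume "v \<in> verts D"
    then show "2 \<le> card {y \<in> verts D. v \<rightarrow>\<^bsub>D\<^esub> y}" "2 \<le> card {y \<in> verts D. y \<rightarrow>\<^bsub>D\<^esub> v}"
      using assms(4) by (auto simp: out_degree_eq in_degree_eq)
  next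
    fix a b z
    assume "a \<noteq> b" "\<not> a \<rightarrow>\<^bsub>D\<^esub> b" "\<not> b \<rightarrow>\<^bsub>D\<^esub> a" "z \<rightarrow>\<^bsub>D\<^esub> a" "z \<rightarrow>\<^bsub>D\<^esub> b"
    then have "nonadjacent D a b" "common_in_neighbour D a b"
      using dominates_in_verts by (auto simp: nonadjacent_def common_in_neighbour_def)
    from assms(5)[OF this]
    show "2 * int (card (verts D)) - 1 \<le> deg (verts D) a + deg (verts D) b \<and>
        int (card (verts D)) - 1 \<le> deg (verts D) a \<and> int (card (verts D)) - 1 \<le> deg (verts D) b"
      using assms(2) by (auto simp: degree_eq[symmetric] min_def split: if_splits)
  next
    fix vs assume "is_cycle vs"
    then obtain c where "cycle c" "length c = length vs" using cycle_of_vertex_list by blast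
    then show "length vs + 1 \<noteq> card (verts D)" using False assms(2) by force
  qed
  have "verts D \<noteq> {}" using assms(3) by (simp add: strongly_connected_def)
  then obtain X Y e where XY: "verts D = X \<union> Y" "X \<inter> Y = {}" "card X = card Y"
    and bip: "\<forall>a b. a \<rightarrow>\<^bsub>D\<^esub> b \<longrightarrow> (a, b) \<in> X \<times> Y \<union> Y \<times> X"
    and almost: "\<forall>a b. (a, b) \<in> X \<times> Y \<union> Y \<times> X \<longrightarrow> (a, b) \<noteq> e \<longrightarrow> a \<rightarrow>\<^bsub>D\<^esub> b"
    using bipartite_if_no_prehamiltonian unfolding balanced_bipartite_up_to_one_arc_def by metis
  have "finite X" "finite Y" using XY(1) by (metis finite_Un finite_verts)+
  then have n: "n = 2 * card X" using XY assms(2) card_Un_disjoint[of X Y] by simp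
  then have k: "card X = n div 2" "card Y = n div 2" using XY(3) by auto
  have "digraph_iso D (standard_bipartite (n div 2)) \<or>
    (\<exists>e\<in>arcs (standard_bipartite (n div 2)).
      digraph_iso D (pre_digraph.del_arc (standard_bipartite (n div 2)) e))"
    by (rule iso_standard_bipartite[OF XY(1,2) k, of e]) (use bip almost in blast)+
  then show ?thesis using n complete_bipartite_standard by auto
qed simp

end
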